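(* Let $(\Omega,\Sigma,\mu)$ and $(\Omega,\Sigma,\nu)$ be two $\sigma$-finite measure spaces, let $p,q\in[1,+\infty]$, and let $g\in L_0(\Omega,\mu)$ be such that the multiplication operator $M_g:L_p(\Omega,\mu)\to L_q(\Omega,\nu)$, $f\mapsto g\cdot f$, is a well-defined bounded operator. Let $\mu=\rho_{\mu,\nu}\cdot\nu+\mu_s$ be the Lebesgue decomposition of $\mu$ with respect to $\nu$, with $\Omega=\Omega_c\sqcup\Omega_s$ and $\nu(\Omega_s)=\mu_s(\Omega_c)=0$. Then the following are equivalent: i) $M_g\in\mathcal{B}(L_p(\Omega,\mu),L_q(\Omega,\nu))$ is topologically surjective; ii) $M_g^{\Omega_c}:L_p(\Omega_c,\mu|_{\Omega_c})\to L_q(\Omega_c,\nu|_{\Omega_c})$ is topologically surjective; iii) $\rho_{\mu,\nu}$ is positive, $|g\cdot\rho_{\mu,\nu}^{-1/p}|_{\Omega_c}|\geq c$ for some constant $c>0$, and if $p\neq q$ the space $(\Omega,\Sigma,\nu)$ consists of finitely many atoms.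
   Context: All linear spaces are over $\mathbb{C}$; measures are nonnegative, $\sigma$-additive, with values in $[0,+\infty]$. $L_0(\Omega,\mu)$ is the space of measurable complex functions on $\Omega$. If $p=\infty$ then $1/p=0$. Equalities and inequalities between functions (including positivity) are understood up to sets of measure zero (here with respect to $\nu$). For a nonnegative measurable $\rho$, $(\rho\cdot\nu)(E)=\int_E\rho\,d\nu$. Lebesgue decomposition of $\mu$ with respect to $\nu$: a nonnegative measurable function $\rho_{\mu,\nu}$, a $\sigma$-finite measure $\mu_s$ and a set $\Omega_s\in\Sigma$ such that $\mu=\rho_{\mu,\nu}\cdot\nu+\mu_s$ and $\nu(\Omega_s)=\mu_s(\Omega_c)=0$, where $\Omega_c=\Omega\setminus\Omega_s$. For $E\in\Sigma$, $M_g^E:L_p(E,\mu|_E)\to L_q(E,\nu|_E)$ is the operator $f\mapsto g|_E\cdot f$. A bounded operator $T:X\to Y$ between normed spaces is topologically surjective if there is $c>0$ such that for every $y\in Y$ there is $x\in X$ with $T(x)=y$ and $\|x\|\leq c\|y\|$. An atom of $(\Omega,\Sigma,\nu)$ is a set $\Omega'\in\Sigma$ with $\nu(\Omega')>0$ such that for every $E\in\Sigma$ with $E\subset\Omega'$ either $\nu(E)=0$ or $\nu(\Omega'\setminus E)=0$. "$(\Omega,\Sigma,\nu)$ consists of finitely many atoms" means that, up to a $\nu$-null set, $\Omega$ is a finite disjoint union of atoms. *)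

theory Defs
  imports "HOL-Probability.Essential_Supremum"
begin

section \<open>Bounded operators between normed spaces\<close>

text \<open>
  The spaces below depend on a measure, hence they cannot be types of class
  \<open>real_normed_vector\<close>; they are given by explicit carriers and operations.
\<close>

record 'v nspace =
  vecs :: "'v set"
  vadd :: "'v \<Rightarrow> 'v \<Rightarrow> 'v"
  vscale :: "complex \<Rightarrow> 'v \<Rightarrow> 'v"
  vnorm :: "'v \<Rightarrow> real"

definition bounded_operator :: "'v nspace \<Rightarrow> 'w nspace \<Rightarrow> ('v \<Rightarrow> 'w) \<Rightarrow> bool" where
  "bounded_operator X Y T \<longleftrightarrow>
     (\<forall>x\<in>vecs X. T x \<in> vecs Y) \<and>
     (\<forall>x\<in>vecs X. \<forall>y\<in>vecs X. T (vadd X x y) = vadd Y (T x) (T y)) \<and>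
     (\<forall>a. \<forall>x\<in>vecs X. T (vscale X a x) = vscale Y a (T x)) \<and>
     (\<exists>K. \<forall>x\<in>vecs X. vnorm Y (T x) \<le> K * vnorm X x)"

definition topologically_surjective :: "'v nspace \<Rightarrow> 'w nspace \<Rightarrow> ('v \<Rightarrow> 'w) \<Rightarrow> bool" where
  "topologically_surjective X Y T \<longleftrightarrow>
     bounded_operator X Y T \<and>
     (\<exists>c>0. \<forall>y\<in>vecs Y. \<exists>x\<in>vecs X. T x = y \<and> vnorm X x \<le> c * vnorm Y y)"


section \<open>The spaces \<open>L\<^sub>p\<close>\<close>

definition ae_class :: "'a measure \<Rightarrow> ('a \<Rightarrow> complex) \<Rightarrow> ('a \<Rightarrow> complex) set" where
  "ae_class M f = {h \<in> borel_measurable M. AE x in M. h x = f x}"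

text \<open>
  The essential supremum is taken in \<^typ>\<open>ennreal\<close>, so that it is \<open>0\<close> (and not \<open>-\<infinity>\<close>)
  when \<open>M\<close> is the zero measure.
\<close>

definition Lp_functions :: "ennreal \<Rightarrow> 'a measure \<Rightarrow> ('a \<Rightarrow> complex) set" where
  "Lp_functions p M = {f \<in> borel_measurable M.
     if p = \<infinity> then esssup M (\<lambda>x. ennreal (norm (f x))) < \<infinity>
     else integrable M (\<lambda>x. norm (f x) powr enn2real p)}"

definition Lp_seminorm :: "ennreal \<Rightarrow> 'a measure \<Rightarrow> ('a \<Rightarrow> complex) \<Rightarrow> real" where
  "Lp_seminorm p M f =
     (if p = \<infinity> then enn2real (esssup M (\<lambda>x. ennreal (norm (f x))))
      else (\<integral>x. norm (f x) powr enn2real p \<partial>M) powr (1 / enn2real p))"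

text \<open>
  Elements of \<open>L\<^sub>p\<close> are classes of functions modulo equality almost everywhere.  Each operation
  is the union of the classes obtained from all representatives; these classes coincide, so
  the union is the class of the sum or of the multiple of any representatives.
\<close>

definition Lp :: "ennreal \<Rightarrow> 'a measure \<Rightarrow> ('a \<Rightarrow> complex) set nspace" where
  "Lp p M =
     \<lparr>vecs = ae_class M ` Lp_functions p M,
      vadd = (\<lambda>F G. \<Union>f\<in>F. \<Union>h\<in>G. ae_class M (\<lambda>x. f x + h x)),
      vscale = (\<lambda>a F. \<Union>f\<in>F. ae_class M (\<lambda>x. a * f x)),
      vnorm = (\<lambda>F. Lp_seminorm p M (SOME f. f \<in> F))\<rparr>"

text \<open>
  The map \<open>f \<mapsto> g \<cdot> f\<close> from classes modulo some measure \<open>M\<close> to classes modulo \<open>N\<close>.  Changing the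
  representative \<open>f\<close> on an \<open>M\<close>-null set may change the \<open>N\<close>-class of \<open>g \<cdot> f\<close>.  The union is a
  single \<open>N\<close>-class iff this does not happen, so \<open>\<forall>F \<in> vecs (Lp p M). mult_op N g F \<in> vecs (Lp q N)\<close>
  says exactly that multiplication by \<open>g\<close> is well defined from \<open>L\<^sub>p(M)\<close> to \<open>L\<^sub>q(N)\<close>;
  see \<open>mult_op_well_defined_iff\<close> below.
\<close>

definition mult_op ::
  "'a measure \<Rightarrow> ('a \<Rightarrow> complex) \<Rightarrow> ('a \<Rightarrow> complex) set \<Rightarrow> ('a \<Rightarrow> complex) set" where
  "mult_op N g F = (\<Union>f\<in>F. ae_class N (\<lambda>x. g x * f x))"

lemma Lp_functions_cong:
  assumes f: "f \<in> Lp_functions p M" and h: "h \<in> borel_measurable M"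
    and eq: "AE x in M. h x = f x"
  shows "h \<in> Lp_functions p M" "Lp_seminorm p M h = Lp_seminorm p M f"
proof -
  have [measurable]: "f \<in> borel_measurable M" "h \<in> borel_measurable M"
    using f h by (auto simp: Lp_functions_def)
  have 1: "esssup M (\<lambda>x. ennreal (norm (h x))) = esssup M (\<lambda>x. ennreal (norm (f x)))"
    using eq by (intro esssup_AE_cong) auto
  have 2: "integrable M (\<lambda>x. norm (h x) powr enn2real p) =
      integrable M (\<lambda>x. norm (f x) powr enn2real p)"
    using eq by (intro integrable_cong_AE) auto
  have 3: "(\<integral>x. norm (h x) powr enn2real p \<partial>M) = (\<integral>x. norm (f x) powr enn2real p \<partial>M)"
    using eq by (intro integral_cong_AE) auto
  show "h \<in> Lp_functions p M" using f h 1 2 by (auto simp: Lp_functions_def)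
  show "Lp_seminorm p M h = Lp_seminorm p M f" using 1 3 by (simp add: Lp_seminorm_def)
qed

lemma vnorm_ae_class:
  assumes f: "f \<in> Lp_functions p M"
  shows "vnorm (Lp p M) (ae_class M f) = Lp_seminorm p M f"
proof -
  have "f \<in> ae_class M f" using f by (auto simp: ae_class_def Lp_functions_def)
  then have "(SOME h. h \<in> ae_class M f) \<in> ae_class M f"
    by (rule someI[where P = "\<lambda>h. h \<in> ae_class M f"])
  then show ?thesis
    using Lp_functions_cong(2)[OF f] by (auto simp: Lp_def ae_class_def)
qed

lemma mult_op_well_defined_iff:
  assumes sets: "sets M = sets N" and g: "g \<in> borel_measurable M"
  shows "(\<forall>F \<in> vecs (Lp p M). mult_op N g F \<in> vecs (Lp q N)) \<longleftrightarrow>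
    (\<forall>f \<in> Lp_functions p M. (\<lambda>x. g x * f x) \<in> Lp_functions q N) \<and>
    (\<forall>f \<in> Lp_functions p M. \<forall>h \<in> Lp_functions p M.
       (AE x in M. f x = h x) \<longrightarrow> (AE x in N. g x * f x = g x * h x))"
    (is "?L \<longleftrightarrow> ?R1 \<and> ?R2")
proof (intro iffI conjI ballI impI)
  have MN: "borel_measurable M = (borel_measurable N :: ('a \<Rightarrow> complex) set)"
    using sets by (simp cong: measurable_cong_sets)
  have meas: "(\<lambda>x. g x * f x) \<in> borel_measurable N" if "f \<in> borel_measurable M" for f
    using g that MN by auto
  have mem: "(\<lambda>x. g x * h x) \<in> mult_op N g (ae_class M f)"
    if "f \<in> Lp_functions p M" "h \<in> borel_measurable M" "AE x in M. h x = f x" for f h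
    using that meas[of h] by (auto simp: mult_op_def ae_class_def intro!: bexI[of _ h])
  {
    assume L: ?L
    have ex: "\<exists>k \<in> Lp_functions q N. mult_op N g (ae_class M f) = ae_class N k"
      if "f \<in> Lp_functions p M" for f
      using L that by (auto simp: Lp_def)
    show "(\<lambda>x. g x * f x) \<in> Lp_functions q N" if f: "f \<in> Lp_functions p M" for f
    proof -
      obtain k where k: "k \<in> Lp_functions q N" "mult_op N g (ae_class M f) = ae_class N k"
        using ex[OF f] by auto
      have "(\<lambda>x. g x * f x) \<in> ae_class N k"
        using mem[OF f, of f] f k(2) by (auto simp: Lp_functions_def)
      then show ?thesis using Lp_functions_cong(1)[OF k(1)] by (auto simp: ae_class_def)
    qed
    show "AE x in N. g x * f x = g x * h x"
      if f: "f \<in> Lp_functions p M" and h: "h \<in> Lp_functions p M"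
        and eq: "AE x in M. f x = h x" for f h
    proof -
      obtain k where k: "mult_op N g (ae_class M h) = ae_class N k"
        using ex[OF h] by auto
      have "(\<lambda>x. g x * f x) \<in> ae_class N k" "(\<lambda>x. g x * h x) \<in> ae_class N k"
        using mem[OF h, of f] mem[OF h, of h] f h eq k by (auto simp: Lp_functions_def)
      then have "AE x in N. g x * f x = k x" "AE x in N. g x * h x = k x"
        by (simp_all add: ae_class_def)
      then show ?thesis by eventually_elim simp
    qed
  }
  show "mult_op N g F \<in> vecs (Lp q N)" if R: "?R1 \<and> ?R2" and F: "F \<in> vecs (Lp p M)" for F
  proof -
    obtain f where f: "f \<in> Lp_functions p M" "F = ae_class M f"
      using F by (auto simp: Lp_def)
    have *: "ae_class N (\<lambda>x. g x * h x) = ae_class N (\<lambda>x. g x * f x)" if h: "h \<in> F" for h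
    proof -
      have h': "h \<in> borel_measurable M" "AE x in M. h x = f x"
        using h f by (simp_all add: ae_class_def)
      have eq: "AE x in N. g x * h x = g x * f x"
        by (rule R[THEN conjunct2, THEN bspec, THEN bspec, THEN mp,
              OF Lp_functions_cong(1)[OF f(1) h'] f(1) h'(2)])
      have 1: "AE x in N. k x = g x * f x" if "AE x in N. k x = g x * h x" for k
        using eq that
      proof eventually_elim
        case (elim x)
        show ?case using elim(2) unfolding elim(1) .
      qed
      have 2: "AE x in N. k x = g x * h x" if "AE x in N. k x = g x * f x" for k
        using eq that
      proof eventually_elim
        case (elim x)
        show ?case using elim(2) unfolding elim(1) .
      qed
      show ?thesis unfolding ae_class_def using 1 2 by (intro Collect_cong conj_cong refl iffI)
    qed
    have "f \<in> F" using f by (auto simp: ae_class_def Lp_functions_def)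
    then have "mult_op N g F = ae_class N (\<lambda>x. g x * f x)"
      unfolding mult_op_def using * by (intro SUP_eq_const) blast+
    moreover have "(\<lambda>x. g x * f x) \<in> Lp_functions q N"
      using R[THEN conjunct1] f(1) by (rule bspec)
    ultimately show ?thesis by (simp add: Lp_def)
  qed
qed


section \<open>Lebesgue decomposition and atoms\<close>

text \<open>\<open>\<rho>\<close> is nonnegative up to a \<open>\<nu>\<close>-null set, on which its values are irrelevant.\<close>

definition lebesgue_decomposition ::
  "'a measure \<Rightarrow> 'a measure \<Rightarrow> ('a \<Rightarrow> real) \<Rightarrow> 'a measure \<Rightarrow> 'a set \<Rightarrow> bool" where
  "lebesgue_decomposition \<mu> \<nu> \<rho> \<mu>s \<Omega>s \<longleftrightarrow>
     \<rho> \<in> borel_measurable \<nu> \<and> (AE x in \<nu>. 0 \<le> \<rho> x) \<and>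
     sigma_finite_measure \<mu>s \<and> sets \<mu>s = sets \<nu> \<and>
     (\<forall>E\<in>sets \<nu>. emeasure \<mu> E = emeasure (density \<nu> (\<lambda>x. ennreal (\<rho> x))) E + emeasure \<mu>s E) \<and>
     \<Omega>s \<in> sets \<nu> \<and> emeasure \<nu> \<Omega>s = 0 \<and> emeasure \<mu>s (space \<nu> - \<Omega>s) = 0"

definition is_atom :: "'a measure \<Rightarrow> 'a set \<Rightarrow> bool" where
  "is_atom M A \<longleftrightarrow> A \<in> sets M \<and> emeasure M A > 0 \<and>
     (\<forall>E\<in>sets M. E \<subseteq> A \<longrightarrow> emeasure M E = 0 \<or> emeasure M (A - E) = 0)"

text \<open>The empty family is allowed: the zero measure consists of zero atoms.\<close>

definition finitely_many_atoms :: "'a measure \<Rightarrow> bool" where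
  "finitely_many_atoms M \<longleftrightarrow>
     (\<exists>\<A>. finite \<A> \<and> disjoint \<A> \<and> (\<forall>A\<in>\<A>. is_atom M A) \<and> emeasure M (space M - \<Union>\<A>) = 0)"

end

theory Submission
  imports Defs
begin

text \<open>
  Topological surjectivity turns out to force injectivity on \<open>\<Omega>c\<close>, so the theorem really
  characterises the multiplication operators that are isomorphisms of \<open>L\<^sub>p(\<Omega>c, \<mu>)\<close> onto
  \<open>L\<^sub>q(\<nu>)\<close>.

  The operator is well defined on classes only if \<open>g\<close> vanishes \<open>\<nu>\<close>-almost everywhere on each
  \<open>\<mu>\<close>-null set, in particular on the part of \<open>\<Omega>c\<close> where \<open>\<rho>\<close> vanishes.  Where \<open>g\<close> vanishes, no
  indicator has a preimage; hence surjectivity forces \<open>g \<noteq> 0\<close> and \<open>\<rho> > 0\<close> almost everywhere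
  (\<open>lifts_imp_nonzero\<close>).  Then preimages are unique on \<open>\<Omega>c\<close>, and the lifting constant \<open>c\<close> becomes
  a lower bound \<open>\<parallel>f\<parallel> \<le> c \<parallel>g f\<parallel>\<close> (\<open>lifts_imp_bounded_below\<close>).  For \<open>p = q\<close>, testing this bound on
  the indicator of a set where \<open>\<bar>g\<bar> < \<rho>\<^bsup>1/p\<^esup> / (2 c)\<close> shows that this set is null, because
  \<open>f \<mapsto> f \<rho>\<^bsup>1/p\<^esup>\<close> is an isometry from \<open>L\<^sub>p(\<Omega>c, \<mu>)\<close> to \<open>L\<^sub>p(\<nu>)\<close> (\<open>Lp_weight\<close>).

  For \<open>p \<noteq> q\<close>, normalised indicators of \<open>n\<close> disjoint sets have a sum of norm \<open>n\<^bsup>1/p\<^esup>\<close> in \<open>L\<^sub>p\<close>,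
  while the norm of its image in \<open>L\<^sub>q\<close> is comparable to \<open>n\<^bsup>1/q\<^esup>\<close>.  An isomorphism makes these two
  numbers comparable uniformly in \<open>n\<close>, so the number of disjoint sets of positive measure is bounded,
  and a family of maximal size consists of atoms with null complement
  (\<open>lifts_imp_finitely_many_atoms\<close>, \<open>not_finitely_many_atoms_disjoint_family\<close>).  On finitely many
  atoms a positive function is bounded away from zero, which gives the constant in condition (iii).

  Conversely, a preimage of \<open>y\<close> is \<open>y / g\<close> on \<open>\<Omega>c\<close>, extended by zero.  Its norm is that of
  \<open>y \<rho>\<^bsup>1/p\<^esup> / g\<close> in \<open>L\<^sub>p(\<nu>)\<close>, which the lower bound on \<open>\<bar>g\<bar>\<close> controls by the norm of \<open>y\<close> in
  \<open>L\<^sub>p(\<nu>)\<close>.  If \<open>p \<noteq> q\<close>, the latter is controlled by the norm in \<open>L\<^sub>q(\<nu>)\<close>, since on finitely many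
  atoms every \<open>L\<^sub>q\<close> embeds into every \<open>L\<^sub>p\<close> (\<open>finitely_many_atoms_Lp_inclusion\<close>).

  Passing to \<open>\<Omega>c\<close> changes nothing, because \<open>\<Omega>s\<close> is \<open>\<nu>\<close>-null: functions can be cut off and extended
  by zero (\<open>mult_op_restrict_space\<close>).
\<close>

section \<open>The \<open>L\<^sub>p\<close> seminorm\<close>

lemma Lp_functions_measurable: "f \<in> Lp_functions p M \<Longrightarrow> f \<in> borel_measurable M"
  by (simp add: Lp_functions_def)

lemma Lp_seminorm_nonneg: "0 \<le> Lp_seminorm p M f"
  by (simp add: Lp_seminorm_def)

text \<open>
  Together with \<open>Lp_infinityI\<close> this describes \<open>L\<^sub>\<infinity>\<close> by bounds that hold almost everywhere, which is
  the form in which the case \<open>p = \<infinity>\<close> enters all further arguments.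
\<close>

lemma AE_norm_le_Lp_seminorm_infinity:
  assumes "f \<in> Lp_functions \<infinity> M"
  shows "AE x in M. norm (f x) \<le> Lp_seminorm \<infinity> M f"
proof -
  have "esssup M (\<lambda>x. ennreal (norm (f x))) < top"
    using assms by (simp add: Lp_functions_def)
  then have "ennreal (Lp_seminorm \<infinity> M f) = esssup M (\<lambda>x. ennreal (norm (f x)))"
    by (simp add: Lp_seminorm_def)
  then have "AE x in M. ennreal (norm (f x)) \<le> ennreal (Lp_seminorm \<infinity> M f)"
    using esssup_AE[of "\<lambda>x. ennreal (norm (f x))" M] by simp
  then show ?thesis
    by eventually_elim (simp add: Lp_seminorm_nonneg)
qed

lemma Lp_infinityI:
  assumes f[measurable]: "f \<in> borel_measurable M" and "0 \<le> K" and le: "AE x in M. norm (f x) \<le> K"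
  shows "f \<in> Lp_functions \<infinity> M" "Lp_seminorm \<infinity> M f \<le> K"
proof -
  have *: "esssup M (\<lambda>x. ennreal (norm (f x))) \<le> ennreal K"
    using le \<open>0 \<le> K\<close> by (intro esssup_I) (auto elim: eventually_mono)
  then have "esssup M (\<lambda>x. ennreal (norm (f x))) < top"
    by (rule order.strict_trans1) simp
  then show "f \<in> Lp_functions \<infinity> M" by (simp add: Lp_functions_def)
  show "Lp_seminorm \<infinity> M f \<le> K"
    using enn2real_mono[OF *] \<open>0 \<le> K\<close> by (simp add: Lp_seminorm_def)
qed

lemma finite_exponent_ge_1: "1 \<le> p \<Longrightarrow> p \<noteq> \<infinity> \<Longrightarrow> 1 \<le> enn2real p"
  using enn2real_mono[of 1 p] by (simp add: less_top)

text \<open>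
  With the convention \<open>1 / \<infinity> = 0\<close> the real number \<open>enn2real (1 / p)\<close> is the exponent that lets one
  formula cover finite and infinite \<open>p\<close>.
\<close>

lemma enn2real_inverse_exponent:
  assumes "1 \<le> p"
  shows "enn2real (1 / p) = (if p = \<infinity> then 0 else 1 / enn2real p)"
proof (cases p)
  case (real r)
  moreover have "1 \<le> r"
    using assms real by (metis ennreal_1 ennreal_le_iff)
  ultimately show ?thesis
    by (simp add: divide_ennreal flip: ennreal_1)
qed simp

lemma enn2real_inverse_exponent_inj:
  assumes "1 \<le> p" "1 \<le> q" "p \<noteq> q"
  shows "enn2real (1 / p) \<noteq> enn2real (1 / q)"
proof -
  have "enn2real p \<noteq> enn2real q" if "p \<noteq> \<infinity>" "q \<noteq> \<infinity>"
    using that assms(3) by (metis ennreal_enn2real infinity_ennreal_def less_top)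
  then show ?thesis
    using assms finite_exponent_ge_1[of p] finite_exponent_ge_1[of q]
    by (auto simp: enn2real_inverse_exponent)
qed

text \<open>
  Domination.  Homogeneity of the seminorm, and its dependence on the modulus alone, are instances.
\<close>

lemma Lp_mono:
  assumes p: "1 \<le> p" and f[measurable]: "f \<in> borel_measurable M"
    and h: "h \<in> Lp_functions p M" and "0 \<le> K" and le: "AE x in M. norm (f x) \<le> K * norm (h x)"
  shows "f \<in> Lp_functions p M" "Lp_seminorm p M f \<le> K * Lp_seminorm p M h"
proof -
  have [measurable]: "h \<in> borel_measurable M" by (rule Lp_functions_measurable[OF h])
  have "f \<in> Lp_functions p M \<and> Lp_seminorm p M f \<le> K * Lp_seminorm p M h"
  proof (cases "p = \<infinity>")
    case True
    have "AE x in M. norm (h x) \<le> Lp_seminorm p M h"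
      using AE_norm_le_Lp_seminorm_infinity h True by simp
    with le have *: "AE x in M. norm (f x) \<le> K * Lp_seminorm p M h"
    proof eventually_elim
      case (elim x)
      then show ?case using mult_left_mono[OF elim(2) \<open>0 \<le> K\<close>] by linarith
    qed
    show ?thesis
      using Lp_infinityI[OF f _ *] True \<open>0 \<le> K\<close> Lp_seminorm_nonneg[of p M h] by simp
  next
    case False
    define r where "r = enn2real p"
    have r: "1 \<le> r" unfolding r_def using finite_exponent_ge_1 p False by simp
    have int_h: "integrable M (\<lambda>x. norm (h x) powr r)"
      using h False by (simp add: Lp_functions_def r_def)
    then have int: "integrable M (\<lambda>x. K powr r * norm (h x) powr r)" by simp
    have le': "AE x in M. norm (f x) powr r \<le> K powr r * norm (h x) powr r"
      using le
    proof eventually_elim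
      case (elim x)
      have "norm (f x) powr r \<le> (K * norm (h x)) powr r"
        using elim r by (intro powr_mono2) auto
      then show ?case using \<open>0 \<le> K\<close> by (simp add: powr_mult)
    qed
    have int_f: "integrable M (\<lambda>x. norm (f x) powr r)"
      by (rule Bochner_Integration.integrable_bound[OF int]) (use le' in auto)
    have "(\<integral>x. norm (f x) powr r \<partial>M) \<le> K powr r * (\<integral>x. norm (h x) powr r \<partial>M)"
      using integral_mono_AE[OF int_f int le'] by simp
    then have "(\<integral>x. norm (f x) powr r \<partial>M) powr (1 / r)
        \<le> (K powr r * (\<integral>x. norm (h x) powr r \<partial>M)) powr (1 / r)"
      using r by (intro powr_mono2) auto
    also have "\<dots> = K * (\<integral>x. norm (h x) powr r \<partial>M) powr (1 / r)"
      using r \<open>0 \<le> K\<close> by (simp add: powr_mult powr_powr)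
    finally show ?thesis
      using False int_f by (simp add: Lp_functions_def Lp_seminorm_def r_def)
  qed
  then show "f \<in> Lp_functions p M" "Lp_seminorm p M f \<le> K * Lp_seminorm p M h" by auto
qed

lemma Lp_norm_cong:
  assumes p: "1 \<le> p" and f: "f \<in> borel_measurable M" and h: "h \<in> Lp_functions p M"
    and eq: "AE x in M. norm (f x) = norm (h x)"
  shows "f \<in> Lp_functions p M" "Lp_seminorm p M f = Lp_seminorm p M h"
proof -
  have le: "AE x in M. norm (f x) \<le> 1 * norm (h x)" "AE x in M. norm (h x) \<le> 1 * norm (f x)"
    using eq by auto
  show f': "f \<in> Lp_functions p M" by (rule Lp_mono(1)[OF p f h _ le(1)]) simp
  show "Lp_seminorm p M f = Lp_seminorm p M h"
    using Lp_mono(2)[OF p f h _ le(1)] Lp_mono(2)[OF p Lp_functions_measurable[OF h] f' _ le(2)]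
    by simp
qed

lemma Lp_cmult:
  assumes p: "1 \<le> p" and f: "f \<in> Lp_functions p M"
  shows "(\<lambda>x. a * f x) \<in> Lp_functions p M"
    "Lp_seminorm p M (\<lambda>x. a * f x) = norm a * Lp_seminorm p M f"
proof -
  have [measurable]: "f \<in> borel_measurable M" by (rule Lp_functions_measurable[OF f])
  show af: "(\<lambda>x. a * f x) \<in> Lp_functions p M"
    by (rule Lp_mono(1)[OF p _ f, of _ "norm a"]) (auto simp: norm_mult)
  have le: "Lp_seminorm p M (\<lambda>x. a * f x) \<le> norm a * Lp_seminorm p M f"
    by (rule Lp_mono(2)[OF p _ f]) (auto simp: norm_mult)
  show "Lp_seminorm p M (\<lambda>x. a * f x) = norm a * Lp_seminorm p M f"
  proof (cases "a = 0")
    case True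
    then show ?thesis using le Lp_seminorm_nonneg[of p M "\<lambda>x. a * f x"] by simp
  next
    case False
    have "Lp_seminorm p M f \<le> inverse (norm a) * Lp_seminorm p M (\<lambda>x. a * f x)"
      by (rule Lp_mono(2)[OF p _ af]) (use False in \<open>auto simp: norm_mult field_simps\<close>)
    then show ?thesis using le False by (simp add: field_simps)
  qed
qed

lemma Lp_seminorm_eq_0D:
  assumes p: "1 \<le> p" and f: "f \<in> Lp_functions p M" and 0: "Lp_seminorm p M f = 0"
  shows "AE x in M. f x = 0"
proof (cases "p = \<infinity>")
  case True
  then show ?thesis using AE_norm_le_Lp_seminorm_infinity[of f M] f 0 by simp
next
  case False
  then have int: "integrable M (\<lambda>x. norm (f x) powr enn2real p)"
    using f by (simp add: Lp_functions_def)
  have "(\<integral>x. norm (f x) powr enn2real p \<partial>M) = 0"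
    using 0 False by (simp add: Lp_seminorm_def)
  then have "AE x in M. norm (f x) powr enn2real p = 0"
    using integral_nonneg_eq_0_iff_AE[OF int] by simp
  then show ?thesis by simp
qed

lemma Lp_bounded_finite_support:
  assumes p: "1 \<le> p" and f: "f \<in> borel_measurable M" and B: "B \<in> sets M" "emeasure M B < \<infinity>"
    and le: "\<And>x. x \<in> B \<Longrightarrow> norm (f x) \<le> K" "\<And>x. x \<notin> B \<Longrightarrow> f x = 0"
  shows "f \<in> Lp_functions p M"
proof -
  have ind: "(indicator B :: 'a \<Rightarrow> complex) \<in> Lp_functions p M"
  proof (cases "p = \<infinity>")
    case True
    then show ?thesis
      using Lp_infinityI(1)[of "indicator B :: 'a \<Rightarrow> complex" M 1] B by (auto simp: indicator_def)
  next
    case False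
    have "(\<lambda>x. norm (indicator B x :: complex) powr enn2real p) = (indicator B :: 'a \<Rightarrow> real)"
      by (auto simp: indicator_def)
    then show ?thesis using False B by (simp add: Lp_functions_def)
  qed
  have "norm (f x) \<le> max K 0 * norm (indicator B x :: complex)" for x
    using le[of x] by (cases "x \<in> B") auto
  then show ?thesis
    by (intro Lp_mono(1)[OF p f ind, of "max K 0"]) auto
qed

lemma Lp_seminorm_indicator:
  assumes p: "1 \<le> p" and E: "E \<in> sets M" "0 < emeasure M E" "emeasure M E < \<infinity>"
  shows "(indicator E :: 'a \<Rightarrow> complex) \<in> Lp_functions p M"
    "Lp_seminorm p M (indicator E) = measure M E powr enn2real (1 / p)"
    "0 < Lp_seminorm p M (indicator E)"
proof -
  show mem: "(indicator E :: 'a \<Rightarrow> complex) \<in> Lp_functions p M"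
    using E by (intro Lp_bounded_finite_support[OF p, of _ _ E 1]) auto
  have pos: "0 < measure M E"
    using E by (simp add: measure_def enn2real_positive_iff)
  show eq: "Lp_seminorm p M (indicator E) = measure M E powr enn2real (1 / p)"
  proof (cases "p = \<infinity>")
    case True
    have "1 \<le> Lp_seminorm \<infinity> M (indicator E)"
    proof (rule ccontr)
      assume "\<not> ?thesis"
      then have "AE x in M. x \<notin> E"
        using AE_norm_le_Lp_seminorm_infinity[of "indicator E" M] mem True
        by (auto elim!: eventually_mono)
      then show False using E by (simp add: AE_iff_null_sets[symmetric] null_sets_def)
    qed
    moreover have "Lp_seminorm \<infinity> M (indicator E) \<le> 1"
      using E by (intro Lp_infinityI(2)) (auto simp: indicator_def)
    ultimately show ?thesis using True pos by simp
  next
    case False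
    have "(\<lambda>x. norm (indicator E x :: complex) powr enn2real p) = (indicator E :: 'a \<Rightarrow> real)"
      by (auto simp: indicator_def)
    then show ?thesis
      using False E by (simp add: Lp_seminorm_def enn2real_inverse_exponent[OF p])
  qed
  show "0 < Lp_seminorm p M (indicator E)" unfolding eq using pos by simp
qed

text \<open>
  Extension by zero embeds the functions on \<open>A\<close> isometrically.
\<close>

lemma Lp_restrict_space:
  assumes p: "1 \<le> p" and A[measurable]: "A \<in> sets M"
  shows "f \<in> Lp_functions p (restrict_space M A)
      \<longleftrightarrow> (\<lambda>x. indicator A x * f x) \<in> Lp_functions p M"
    "f \<in> Lp_functions p (restrict_space M A)
      \<Longrightarrow> Lp_seminorm p (restrict_space M A) f = Lp_seminorm p M (\<lambda>x. indicator A x * f x)"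
proof -
  have A': "A \<inter> space M \<in> sets M" by simp
  have ind: "indicator A x *\<^sub>R f x = indicator A x * f x" for x
    by (simp add: indicator_def)
  have meas: "f \<in> borel_measurable (restrict_space M A)
      \<longleftrightarrow> (\<lambda>x. indicator A x * f x) \<in> borel_measurable M"
    using borel_measurable_restrict_space_iff[OF A', of f] by (simp add: ind)
  have pow: "norm (indicator A x * f x) powr r = indicator A x *\<^sub>R norm (f x) powr r" for x r
    by (auto simp: indicator_def)
  have AE: "(AE x in M. norm (indicator A x * f x) \<le> K)
      \<longleftrightarrow> (AE x in restrict_space M A. norm (f x) \<le> K)" if "0 \<le> K" for K
    unfolding AE_restrict_space_iff[OF A']
    using that by (intro AE_cong) (auto simp: indicator_def)
  show iff: "f \<in> Lp_functions p (restrict_space M A)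
      \<longleftrightarrow> (\<lambda>x. indicator A x * f x) \<in> Lp_functions p M"
  proof (cases "p = \<infinity>")
    case True
    show ?thesis
    proof
      assume f: "f \<in> Lp_functions p (restrict_space M A)"
      show "(\<lambda>x. indicator A x * f x) \<in> Lp_functions p M"
        using Lp_infinityI(1)[OF _ Lp_seminorm_nonneg] AE_norm_le_Lp_seminorm_infinity f True
          meas Lp_functions_measurable[OF f] AE[OF Lp_seminorm_nonneg] by blast
    next
      assume f: "(\<lambda>x. indicator A x * f x) \<in> Lp_functions p M"
      show "f \<in> Lp_functions p (restrict_space M A)"
        using Lp_infinityI(1)[OF _ Lp_seminorm_nonneg] AE_norm_le_Lp_seminorm_infinity f True
          meas Lp_functions_measurable[OF f] AE[OF Lp_seminorm_nonneg] by blast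
    qed
  next
    case False
    then show ?thesis
      using integrable_restrict_space[OF A', of "\<lambda>x. norm (f x) powr enn2real p"] meas
      by (simp add: Lp_functions_def pow)
  qed
  show "Lp_seminorm p (restrict_space M A) f = Lp_seminorm p M (\<lambda>x. indicator A x * f x)"
    if f: "f \<in> Lp_functions p (restrict_space M A)"
  proof (cases "p = \<infinity>")
    case True
    have *: "(\<lambda>x. indicator A x * f x) \<in> Lp_functions p M" using iff f by simp
    show ?thesis
      using True Lp_infinityI(2)[OF _ Lp_seminorm_nonneg] AE_norm_le_Lp_seminorm_infinity f *
         meas Lp_functions_measurable[OF f] AE[OF Lp_seminorm_nonneg] by (blast intro: antisym)
  next
    case False
    then show ?thesis
      using integral_restrict_space[OF A', of "\<lambda>x. norm (f x) powr enn2real p"]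
      by (simp add: Lp_seminorm_def pow)
  qed
qed

text \<open>
  For finite \<open>p\<close> this is the identity \<open>\<rho> \<bar>f\<bar>\<^bsup>p\<^esup> = \<bar>f \<rho>\<^bsup>1/p\<^esup>\<bar>\<^bsup>p\<^esup>\<close>.  For \<open>p = \<infinity>\<close> the weight is \<open>1\<close>, and a
  positive density does not change the null sets.
\<close>

lemma Lp_density:
  assumes p: "1 \<le> p" and f[measurable]: "f \<in> borel_measurable M"
    and \<rho>[measurable]: "\<rho> \<in> borel_measurable M" and pos: "AE x in M. 0 < \<rho> x"
  shows "f \<in> Lp_functions p (density M (\<lambda>x. ennreal (\<rho> x)))
      \<longleftrightarrow> (\<lambda>x. f x * complex_of_real (\<rho> x powr enn2real (1 / p))) \<in> Lp_functions p M"
    "f \<in> Lp_functions p (density M (\<lambda>x. ennreal (\<rho> x)))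
      \<Longrightarrow> Lp_seminorm p (density M (\<lambda>x. ennreal (\<rho> x))) f
        = Lp_seminorm p M (\<lambda>x. f x * complex_of_real (\<rho> x powr enn2real (1 / p)))"
proof -
  let ?D = "density M (\<lambda>x. ennreal (\<rho> x))"
  let ?F = "\<lambda>x. f x * complex_of_real (\<rho> x powr enn2real (1 / p))"
  have "(f \<in> Lp_functions p ?D \<longleftrightarrow> ?F \<in> Lp_functions p M)
      \<and> (f \<in> Lp_functions p ?D \<longrightarrow> Lp_seminorm p ?D f = Lp_seminorm p M ?F)"
  proof (cases "p = \<infinity>")
    case True
    have AE: "(AE x in ?D. norm (f x) \<le> K) \<longleftrightarrow> (AE x in M. norm (?F x) \<le> K)" for K
    proof -
      have "AE x in M. (0 < ennreal (\<rho> x) \<longrightarrow> norm (f x) \<le> K) = (norm (?F x) \<le> K)"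
        using pos by eventually_elim (simp add: True norm_mult)
      then have "(AE x in M. 0 < ennreal (\<rho> x) \<longrightarrow> norm (f x) \<le> K) = (AE x in M. norm (?F x) \<le> K)"
        by (rule eventually_subst)
      then show ?thesis by (simp add: AE_density)
    qed
    have meas: "f \<in> borel_measurable ?D" "?F \<in> borel_measurable M" by simp_all
    have 1: "?F \<in> Lp_functions p M" "Lp_seminorm p M ?F \<le> Lp_seminorm p ?D f"
      if "f \<in> Lp_functions p ?D"
      using Lp_infinityI[OF meas(2) Lp_seminorm_nonneg[of \<infinity> ?D f]] AE
        AE_norm_le_Lp_seminorm_infinity[of f ?D] that True by auto
    have 2: "f \<in> Lp_functions p ?D" "Lp_seminorm p ?D f \<le> Lp_seminorm p M ?F"
      if "?F \<in> Lp_functions p M"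
      using Lp_infinityI[OF meas(1) Lp_seminorm_nonneg[of \<infinity> M ?F]] AE
        AE_norm_le_Lp_seminorm_infinity[of ?F M] that True by auto
    show ?thesis using 1 2 by (meson antisym)
  next
    case False
    have r: "1 \<le> enn2real p" using finite_exponent_ge_1 p False by simp
    have nn: "AE x in M. 0 \<le> \<rho> x" using pos by eventually_elim simp
    have eq: "AE x in M. norm (?F x) powr enn2real p = \<rho> x *\<^sub>R norm (f x) powr enn2real p"
      using pos
    proof eventually_elim
      case (elim x)
      then show ?case
        using r False by (simp add: norm_mult powr_mult powr_powr enn2real_inverse_exponent[OF p])
    qed
    have int: "integrable ?D (\<lambda>x. norm (f x) powr enn2real p)
        \<longleftrightarrow> integrable M (\<lambda>x. norm (?F x) powr enn2real p)"
      by (subst integrable_density[OF _ \<rho> nn], simp, rule integrable_cong_AE)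
        (use eq in \<open>auto elim: eventually_mono\<close>)
    have "(\<integral>x. norm (f x) powr enn2real p \<partial>?D) = (\<integral>x. norm (?F x) powr enn2real p \<partial>M)"
      by (subst integral_density[OF _ \<rho> nn]) (use eq in \<open>auto intro!: integral_cong_AE\<close>)
    with int show ?thesis using False by (simp add: Lp_functions_def Lp_seminorm_def)
  qed
  then show "f \<in> Lp_functions p ?D \<longleftrightarrow> ?F \<in> Lp_functions p M"
    "f \<in> Lp_functions p ?D \<Longrightarrow> Lp_seminorm p ?D f = Lp_seminorm p M ?F" by auto
qed

text \<open>
  On a function composed of disjointly supported pieces, the \<open>p\<close>-th power of the seminorm is the sum
  of those of the pieces, or the seminorm is their maximum if \<open>p = \<infinity>\<close>.  Either way \<open>n\<close> pieces of
  comparable size contribute the factor \<open>n\<^bsup>1/p\<^esup>\<close>; this growth rate is what tells \<open>L\<^sub>p\<close> and \<open>L\<^sub>q\<close> apart.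
\<close>

lemma Lp_seminorm_disjoint:
  assumes p: "1 \<le> p" and f: "f \<in> Lp_functions p M"
    and \<B>: "finite \<B>" "disjoint \<B>" "\<B> \<subseteq> sets M" and supp: "\<And>x. x \<notin> \<Union>\<B> \<Longrightarrow> f x = 0"
  shows "\<lbrakk>\<And>B. B \<in> \<B> \<Longrightarrow> Lp_seminorm p M (\<lambda>x. indicator B x * f x) \<le> b; 0 \<le> b\<rbrakk>
      \<Longrightarrow> Lp_seminorm p M f \<le> b * real (card \<B>) powr enn2real (1 / p)"
    and "\<lbrakk>\<And>B. B \<in> \<B> \<Longrightarrow> a \<le> Lp_seminorm p M (\<lambda>x. indicator B x * f x); 0 \<le> a; \<B> \<noteq> {}\<rbrakk>
      \<Longrightarrow> a * real (card \<B>) powr enn2real (1 / p) \<le> Lp_seminorm p M f"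
proof -
  note f_meas[measurable] = Lp_functions_measurable[OF f]
  have part: "(\<lambda>x. indicator B x * f x) \<in> Lp_functions p M"
    and part_le: "Lp_seminorm p M (\<lambda>x. indicator B x * f x) \<le> Lp_seminorm p M f"
    if "B \<in> \<B>" for B
  proof -
    have [measurable]: "B \<in> sets M" using \<B> that by auto
    show "(\<lambda>x. indicator B x * f x) \<in> Lp_functions p M"
      by (rule Lp_mono(1)[OF p _ f, of _ 1]) (auto simp: indicator_def)
    have "Lp_seminorm p M (\<lambda>x. indicator B x * f x) \<le> 1 * Lp_seminorm p M f"
      by (rule Lp_mono(2)[OF p _ f]) (auto simp: indicator_def)
    then show "Lp_seminorm p M (\<lambda>x. indicator B x * f x) \<le> Lp_seminorm p M f" by simp
  qed
  have pow: "Lp_seminorm p M f powr r = (\<Sum>B\<in>\<B>. Lp_seminorm p M (\<lambda>x. indicator B x * f x) powr r)"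
    if fin: "p \<noteq> \<infinity>" and r_def: "r = enn2real p" for r
  proof -
    have r: "1 \<le> r" unfolding r_def using finite_exponent_ge_1 p fin by simp
    have *: "Lp_seminorm p M h powr r = (\<integral>x. norm (h x) powr r \<partial>M)" for h
      using fin r by (simp add: Lp_seminorm_def r_def powr_powr)
    have "norm (f x) powr r = (\<Sum>B\<in>\<B>. norm (indicator B x * f x) powr r)" for x
    proof (cases "x \<in> \<Union>\<B>")
      case True
      then obtain B where B: "B \<in> \<B>" "x \<in> B" by auto
      then have "x \<notin> B'" if "B' \<in> \<B> - {B}" for B'
        using \<B>(2) that by (auto simp: disjoint_def)
      then have "(\<Sum>B'\<in>\<B>-{B}. norm (indicator B' x * f x) powr r) = 0"
        by (intro sum.neutral) auto
      then show ?thesis using B by (simp add: sum.remove[OF \<B>(1) B(1)])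
    next
      case False
      then show ?thesis using supp by simp
    qed
    then have "(\<integral>x. norm (f x) powr r \<partial>M) = (\<integral>x. (\<Sum>B\<in>\<B>. norm (indicator B x * f x) powr r) \<partial>M)"
      by simp
    also have "\<dots> = (\<Sum>B\<in>\<B>. \<integral>x. norm (indicator B x * f x) powr r \<partial>M)"
      using part fin by (intro Bochner_Integration.integral_sum) (auto simp: Lp_functions_def r_def)
    finally show ?thesis by (simp add: *)
  qed
  {
    assume le: "\<And>B. B \<in> \<B> \<Longrightarrow> Lp_seminorm p M (\<lambda>x. indicator B x * f x) \<le> b" and "0 \<le> b"
    show "Lp_seminorm p M f \<le> b * real (card \<B>) powr enn2real (1 / p)"
    proof (cases "p = \<infinity>")
      case True
      have "AE x in M. \<forall>B\<in>\<B>. norm (indicator B x * f x) \<le> b"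
      proof (intro AE_finite_allI \<B>)
        fix B assume B: "B \<in> \<B>"
        have "AE x in M. norm (indicator B x * f x) \<le> Lp_seminorm p M (\<lambda>x. indicator B x * f x)"
          using AE_norm_le_Lp_seminorm_infinity part[OF B] True by blast
        then show "AE x in M. norm (indicator B x * f x) \<le> b"
          using le[OF B] by (auto elim!: eventually_mono intro: order_trans)
      qed
      then have "AE x in M. norm (f x) \<le> (if \<B> = {} then 0 else b)"
      proof eventually_elim
        case (elim x)
        show ?case
        proof (cases "x \<in> \<Union>\<B>")
          case True
          then obtain B where "B \<in> \<B>" "x \<in> B" by auto
          with elim[rule_format, OF this(1)] show ?thesis by auto
        next
          case False
          then show ?thesis using supp[OF False] \<open>0 \<le> b\<close> by simp
        qed
      qed
      then have "Lp_seminorm p M f \<le> (if \<B> = {} then 0 else b)"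
        using Lp_infinityI(2)[OF f_meas] True \<open>0 \<le> b\<close> by simp
      then show ?thesis using True \<B>(1) by (auto split: if_splits)
    next
      case False
      define r where "r = enn2real p"
      have r: "1 \<le> r" unfolding r_def using finite_exponent_ge_1 p False by simp
      have "Lp_seminorm p M f powr r \<le> (\<Sum>B\<in>\<B>. b powr r)"
        unfolding pow[OF False r_def] using le r by (intro sum_mono powr_mono2) (auto simp: Lp_seminorm_nonneg)
      then have "(Lp_seminorm p M f powr r) powr (1/r) \<le> (real (card \<B>) * b powr r) powr (1/r)"
        using r by (intro powr_mono2) auto
      then show ?thesis
        using r \<open>0 \<le> b\<close> False Lp_seminorm_nonneg[of p M f]
        by (simp add: powr_mult powr_powr enn2real_inverse_exponent[OF p] r_def mult.commute)
    qed
  }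
  {
    assume le: "\<And>B. B \<in> \<B> \<Longrightarrow> a \<le> Lp_seminorm p M (\<lambda>x. indicator B x * f x)"
      and "0 \<le> a" "\<B> \<noteq> {}"
    show "a * real (card \<B>) powr enn2real (1 / p) \<le> Lp_seminorm p M f"
    proof (cases "p = \<infinity>")
      case True
      obtain B where "B \<in> \<B>" using \<open>\<B> \<noteq> {}\<close> by auto
      then have "a \<le> Lp_seminorm p M f" using le part_le order_trans by blast
      then show ?thesis using True \<B>(1) \<open>\<B> \<noteq> {}\<close> by simp
    next
      case False
      define r where "r = enn2real p"
      have r: "1 \<le> r" unfolding r_def using finite_exponent_ge_1 p False by simp
      have "(\<Sum>B\<in>\<B>. a powr r) \<le> Lp_seminorm p M f powr r"
        unfolding pow[OF False r_def] using le r \<open>0 \<le> a\<close> by (intro sum_mono powr_mono2) auto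
      then have "(real (card \<B>) * a powr r) powr (1/r) \<le> (Lp_seminorm p M f powr r) powr (1/r)"
        using r by (intro powr_mono2) auto
      then show ?thesis
        using r \<open>0 \<le> a\<close> False Lp_seminorm_nonneg[of p M f]
        by (simp add: powr_mult powr_powr enn2real_inverse_exponent[OF p] r_def mult.commute)
    qed
  }
qed

section \<open>Multiplication operators in terms of representatives\<close>

lemma ae_class_cong:
  assumes "AE x in M. f x = h x"
  shows "ae_class M f = ae_class M h"
proof -
  have "(AE x in M. k x = f x) \<longleftrightarrow> (AE x in M. k x = h x)" for k
  proof (rule eventually_subst)
    show "AE x in M. (k x = f x) = (k x = h x)"
      using assms by eventually_elim simp
  qed
  then show ?thesis by (simp add: ae_class_def)
qed

lemma ae_class_self: "f \<in> borel_measurable M \<Longrightarrow> f \<in> ae_class M f"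
  by (simp add: ae_class_def)

lemma ae_class_eqD:
  assumes "ae_class M f = ae_class M h" "f \<in> borel_measurable M"
  shows "AE x in M. f x = h x"
proof -
  have "f \<in> ae_class M h" using ae_class_self[OF assms(2)] assms(1) by simp
  then show ?thesis by (simp add: ae_class_def)
qed

lemma vadd_ae_class:
  assumes "f \<in> borel_measurable M" "h \<in> borel_measurable M"
  shows "vadd (Lp p M) (ae_class M f) (ae_class M h) = ae_class M (\<lambda>x. f x + h x)"
proof -
  have *: "ae_class M (\<lambda>x. f' x + h' x) = ae_class M (\<lambda>x. f x + h x)"
    if "f' \<in> ae_class M f" "h' \<in> ae_class M h" for f' h'
  proof (rule ae_class_cong)
    have "AE x in M. f' x = f x" "AE x in M. h' x = h x"
      using that by (simp_all add: ae_class_def)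
    then show "AE x in M. f' x + h' x = f x + h x" by eventually_elim simp
  qed
  have "vadd (Lp p M) (ae_class M f) (ae_class M h)
      = (\<Union>f'\<in>ae_class M f. \<Union>h'\<in>ae_class M h. ae_class M (\<lambda>x. f x + h x))"
    unfolding Lp_def by (simp add: * cong: SUP_cong)
  then show ?thesis using ae_class_self[OF assms(1)] ae_class_self[OF assms(2)] by auto
qed

lemma vscale_ae_class:
  assumes "f \<in> borel_measurable M"
  shows "vscale (Lp p M) a (ae_class M f) = ae_class M (\<lambda>x. a * f x)"
proof -
  have *: "ae_class M (\<lambda>x. a * f' x) = ae_class M (\<lambda>x. a * f x)" if "f' \<in> ae_class M f" for f'
    using that by (intro ae_class_cong) (auto simp: ae_class_def elim: eventually_mono)
  have "vscale (Lp p M) a (ae_class M f) = (\<Union>f'\<in>ae_class M f. ae_class M (\<lambda>x. a * f x))"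
    unfolding Lp_def by (simp add: * cong: SUP_cong)
  then show ?thesis using ae_class_self[OF assms(1)] by auto
qed

lemma AE_mult_cong:
  fixes f g h :: "'a \<Rightarrow> complex"
  assumes null: "\<And>E. E \<in> null_sets M \<Longrightarrow> AE x in N. x \<in> E \<longrightarrow> g x = 0"
    and sets: "sets M = sets N"
    and meas[measurable]: "f \<in> borel_measurable M" "h \<in> borel_measurable M"
    and eq: "AE x in M. f x = h x"
  shows "AE x in N. g x * f x = g x * h x"
proof -
  have "{x\<in>space M. f x \<noteq> h x} \<in> null_sets M"
    using eq by (subst (asm) AE_iff_null) auto
  from null[OF this] AE_space[of N] show ?thesis
    by eventually_elim (use sets_eq_imp_space_eq[OF sets] in auto)
qed

lemma mult_op_ae_class:
  assumes null: "\<And>E. E \<in> null_sets M \<Longrightarrow> AE x in N. x \<in> E \<longrightarrow> g x = 0"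
    and sets: "sets M = sets N" and f: "f \<in> borel_measurable M"
  shows "mult_op N g (ae_class M f) = ae_class N (\<lambda>x. g x * f x)"
proof -
  have *: "ae_class N (\<lambda>x. g x * f' x) = ae_class N (\<lambda>x. g x * f x)" if "f' \<in> ae_class M f" for f'
    using that by (intro ae_class_cong AE_mult_cong[OF null sets _ f]) (auto simp: ae_class_def)
  have "mult_op N g (ae_class M f) = (\<Union>f'\<in>ae_class M f. ae_class N (\<lambda>x. g x * f x))"
    unfolding mult_op_def by (simp add: * cong: SUP_cong)
  then show ?thesis using ae_class_self[OF f] by auto
qed

text \<open>
  Well-definedness on classes is tested on the functions \<open>0\<close> and \<open>indicator E\<close> with \<open>E\<close> null, which
  belong to \<open>L\<^sub>p\<close> for every \<open>p\<close>.  The resulting condition on null sets gives a well-defined action on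
  the classes of all measurable functions, so that additivity follows pointwise, without knowing
  that sums stay in \<open>L\<^sub>p\<close>.
\<close>

lemma bounded_operator_mult_op_iff:
  assumes sets: "sets M = sets N" and g: "g \<in> borel_measurable M" and p: "1 \<le> p"
  shows "bounded_operator (Lp p M) (Lp q N) (mult_op N g) \<longleftrightarrow>
    (\<forall>E\<in>null_sets M. AE x in N. x \<in> E \<longrightarrow> g x = 0) \<and>
    (\<forall>f\<in>Lp_functions p M. (\<lambda>x. g x * f x) \<in> Lp_functions q N) \<and>
    (\<exists>K. \<forall>f\<in>Lp_functions p M. Lp_seminorm q N (\<lambda>x. g x * f x) \<le> K * Lp_seminorm p M f)"
    (is "_ \<longleftrightarrow> ?null \<and> ?maps \<and> ?bd")
proof -
  have MN: "borel_measurable M = (borel_measurable N :: ('a \<Rightarrow> complex) set)"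
    using sets by (simp cong: measurable_cong_sets)
  have vecs: "vecs (Lp r L) = ae_class L ` Lp_functions r L" for r and L :: "'a measure"
    by (simp add: Lp_def)
  have wd: "(\<forall>F\<in>vecs (Lp p M). mult_op N g F \<in> vecs (Lp q N)) \<longleftrightarrow> ?null \<and> ?maps"
  proof
    assume "\<forall>F\<in>vecs (Lp p M). mult_op N g F \<in> vecs (Lp q N)"
    then have maps: ?maps and cong: "\<And>f h. \<lbrakk>f \<in> Lp_functions p M; h \<in> Lp_functions p M;
        AE x in M. f x = h x\<rbrakk> \<Longrightarrow> AE x in N. g x * f x = g x * h x"
      unfolding mult_op_well_defined_iff[OF sets g] by auto
    have "AE x in N. x \<in> E \<longrightarrow> g x = 0" if E: "E \<in> null_sets M" for E
    proof -
      have "AE x in N. g x * indicator E x = g x * 0"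
      proof (rule cong)
        show "(indicator E :: 'a \<Rightarrow> complex) \<in> Lp_functions p M"
          using E by (intro Lp_bounded_finite_support[OF p, of _ _ E 1]) auto
        show "(\<lambda>x. 0) \<in> Lp_functions p M"
          by (intro Lp_bounded_finite_support[OF p, of _ _ "{}" 1]) auto
        show "AE x in M. indicator E x = (0::complex)"
          using AE_not_in[OF E] by eventually_elim simp
      qed
      then show ?thesis by eventually_elim (auto simp: indicator_def split: if_splits)
    qed
    with maps show "?null \<and> ?maps" by blast
  next
    assume R: "?null \<and> ?maps"
    show "\<forall>F\<in>vecs (Lp p M). mult_op N g F \<in> vecs (Lp q N)"
      unfolding mult_op_well_defined_iff[OF sets g]
      using R AE_mult_cong[OF _ sets Lp_functions_measurable Lp_functions_measurable] by blast
  qed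
  show ?thesis
  proof (cases "?null \<and> ?maps")
    case False
    then show ?thesis using wd by (auto simp: bounded_operator_def)
  next
    case True
    then have maps: ?maps by blast
    have op: "mult_op N g (ae_class M f) = ae_class N (\<lambda>x. g x * f x)" if "f \<in> borel_measurable M" for f
      using mult_op_ae_class[OF _ sets that] True by blast
    have gf: "(\<lambda>x. g x * f x) \<in> borel_measurable N" if "f \<in> borel_measurable M" for f
      using that g unfolding MN by simp
    have add: "mult_op N g (vadd (Lp p M) F H) = vadd (Lp q N) (mult_op N g F) (mult_op N g H)"
      if FH: "F \<in> vecs (Lp p M)" "H \<in> vecs (Lp p M)" for F H
    proof -
      obtain f h where fh: "F = ae_class M f" "H = ae_class M h"
        and [measurable]: "f \<in> borel_measurable M" "h \<in> borel_measurable M"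
        using FH by (auto simp: vecs dest: Lp_functions_measurable)
      show ?thesis by (simp add: fh vadd_ae_class op gf distrib_left)
    qed
    have scale: "mult_op N g (vscale (Lp p M) a F) = vscale (Lp q N) a (mult_op N g F)"
      if F: "F \<in> vecs (Lp p M)" for F a
    proof -
      obtain f where f: "F = ae_class M f" and [measurable]: "f \<in> borel_measurable M"
        using F by (auto simp: vecs dest: Lp_functions_measurable)
      show ?thesis by (simp add: f vscale_ae_class op gf mult.left_commute)
    qed
    have norm: "vnorm (Lp q N) (mult_op N g (ae_class M f)) = Lp_seminorm q N (\<lambda>x. g x * f x)"
      if "f \<in> Lp_functions p M" for f
      using that maps by (simp add: op[OF Lp_functions_measurable] vnorm_ae_class)
    have "(\<exists>K. \<forall>F\<in>vecs (Lp p M). vnorm (Lp q N) (mult_op N g F) \<le> K * vnorm (Lp p M) F) \<longleftrightarrow> ?bd"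
      by (simp add: vecs norm vnorm_ae_class)
    then show ?thesis
      unfolding bounded_operator_def using wd True add scale by blast
  qed
qed

lemma topologically_surjective_mult_op_iff:
  assumes sets: "sets M = sets N" and g: "g \<in> borel_measurable M" and p: "1 \<le> p"
    and bd: "bounded_operator (Lp p M) (Lp q N) (mult_op N g)"
  shows "topologically_surjective (Lp p M) (Lp q N) (mult_op N g) \<longleftrightarrow>
    (\<exists>c>0. \<forall>y\<in>Lp_functions q N. \<exists>f\<in>Lp_functions p M.
       (AE x in N. g x * f x = y x) \<and> Lp_seminorm p M f \<le> c * Lp_seminorm q N y)"
proof -
  have MN: "borel_measurable M = (borel_measurable N :: ('a \<Rightarrow> complex) set)"
    using sets by (simp cong: measurable_cong_sets)
  have vecs: "vecs (Lp r L) = ae_class L ` Lp_functions r L" for r and L :: "'a measure"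
    by (simp add: Lp_def)
  have null: "AE x in N. x \<in> E \<longrightarrow> g x = 0" if "E \<in> null_sets M" for E
    using bd that unfolding bounded_operator_mult_op_iff[OF sets g p] by blast
  have "mult_op N g (ae_class M f) = ae_class N y \<longleftrightarrow> (AE x in N. g x * f x = y x)"
    if "f \<in> Lp_functions p M" for f y
  proof -
    have "(\<lambda>x. g x * f x) \<in> borel_measurable N"
      using Lp_functions_measurable[OF that] g unfolding MN by simp
    then show ?thesis
      using mult_op_ae_class[OF null sets Lp_functions_measurable[OF that]]
        ae_class_eqD ae_class_cong by metis
  qed
  then show ?thesis
    using bd by (simp add: topologically_surjective_def vecs vnorm_ae_class cong: bex_cong conj_cong)
qed

text \<open>
  Both implications keep the lifting constant: a function on the whole space is cut off to \<open>A\<close>, which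
  does not increase its norm, and a function on \<open>A\<close> is extended by zero.  As \<open>A\<close> has null complement
  for \<open>N\<close>, the equation \<open>g f = y\<close> is not affected.
\<close>

lemma mult_op_restrict_space:
  assumes sets: "sets M = sets N" and g: "g \<in> borel_measurable M" and p: "1 \<le> p" and q: "1 \<le> q"
    and A: "A \<in> sets M" and co: "AE x in N. x \<in> A"
    and bd: "bounded_operator (Lp p M) (Lp q N) (mult_op N g)"
  shows "topologically_surjective (Lp p M) (Lp q N) (mult_op N g) \<longleftrightarrow>
    topologically_surjective (Lp p (restrict_space M A)) (Lp q (restrict_space N A))
      (mult_op (restrict_space N A) g)"
proof -
  let ?M = "restrict_space M A" and ?N = "restrict_space N A"
  have AN: "A \<in> sets N" using A sets by simp
  note RM = Lp_restrict_space[OF p A] and RN = Lp_restrict_space[OF q AN]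
  have sets': "sets ?M = sets ?N" using sets by (rule sets_restrict_space_cong)
  have g': "g \<in> borel_measurable ?M" using g by (rule measurable_restrict_space1)
  from bd have null: "\<And>E. E \<in> null_sets M \<Longrightarrow> AE x in N. x \<in> E \<longrightarrow> g x = 0"
    and maps: "\<And>f. f \<in> Lp_functions p M \<Longrightarrow> (\<lambda>x. g x * f x) \<in> Lp_functions q N"
    and "\<exists>K. \<forall>f\<in>Lp_functions p M. Lp_seminorm q N (\<lambda>x. g x * f x) \<le> K * Lp_seminorm p M f"
    unfolding bounded_operator_mult_op_iff[OF sets g p] by blast+
  then obtain K where K: "\<And>f. f \<in> Lp_functions p M
      \<Longrightarrow> Lp_seminorm q N (\<lambda>x. g x * f x) \<le> K * Lp_seminorm p M f" by blast
  have comm: "(\<lambda>x. indicator A x * (g x * f x)) = (\<lambda>x. g x * (indicator A x * f x))" for f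
    by (auto simp: mult.left_commute)
  have bd': "bounded_operator (Lp p ?M) (Lp q ?N) (mult_op ?N g)"
    unfolding bounded_operator_mult_op_iff[OF sets' g' p]
  proof (intro conjI ballI exI)
    fix E assume "E \<in> null_sets ?M"
    then have "E \<in> null_sets M" using A by (simp add: null_sets_restrict_space)
    from null[OF this] show "AE x in ?N. x \<in> E \<longrightarrow> g x = 0"
      using AN by (simp add: AE_restrict_space_iff) (auto elim: eventually_mono)
  next
    fix f assume f: "f \<in> Lp_functions p ?M"
    then have f': "(\<lambda>x. indicator A x * f x) \<in> Lp_functions p M" using RM(1) by blast
    show gf: "(\<lambda>x. g x * f x) \<in> Lp_functions q ?N"
      using maps[OF f'] by (simp add: RN(1) comm)
    show "Lp_seminorm q ?N (\<lambda>x. g x * f x) \<le> K * Lp_seminorm p ?M f"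
      using K[OF f'] by (simp add: RN(2)[OF gf] RM(2)[OF f] comm)
  qed
  have cut: "(\<lambda>x. indicator A x * f x) \<in> Lp_functions r L"
    "Lp_seminorm r L (\<lambda>x. indicator A x * f x) \<le> Lp_seminorm r L f"
    if r: "1 \<le> r" and f: "f \<in> Lp_functions r L" and [measurable]: "A \<in> sets L" for f r L
  proof -
    have [measurable]: "f \<in> borel_measurable L" by (rule Lp_functions_measurable[OF f])
    show "(\<lambda>x. indicator A x * f x) \<in> Lp_functions r L"
      by (rule Lp_mono(1)[OF r _ f, of _ 1]) (auto simp: indicator_def)
    have "Lp_seminorm r L (\<lambda>x. indicator A x * f x) \<le> 1 * Lp_seminorm r L f"
      by (rule Lp_mono(2)[OF r _ f]) (auto simp: indicator_def)
    then show "Lp_seminorm r L (\<lambda>x. indicator A x * f x) \<le> Lp_seminorm r L f" by simp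
  qed
  show ?thesis
    unfolding topologically_surjective_mult_op_iff[OF sets g p bd]
      topologically_surjective_mult_op_iff[OF sets' g' p bd']
  proof (intro ex_cong1 conj_cong refl iffI ballI)
    fix c :: real and y assume c: "0 < c" and y: "y \<in> Lp_functions q ?N"
      and sur: "\<forall>y\<in>Lp_functions q N. \<exists>f\<in>Lp_functions p M.
       (AE x in N. g x * f x = y x) \<and> Lp_seminorm p M f \<le> c * Lp_seminorm q N y"
    obtain f where f: "f \<in> Lp_functions p M" "AE x in N. g x * f x = indicator A x * y x"
      "Lp_seminorm p M f \<le> c * Lp_seminorm q N (\<lambda>x. indicator A x * y x)"
      using sur[rule_format, OF RN(1)[THEN iffD1, OF y]] by blast
    have f': "f \<in> Lp_functions p ?M" using RM(1) cut(1)[OF p f(1) A] by blast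
    have "AE x in ?N. g x * f x = y x"
      using f(2) AN by (simp add: AE_restrict_space_iff) (auto elim: eventually_mono)
    moreover have "Lp_seminorm p ?M f \<le> c * Lp_seminorm q ?N y"
      using cut(2)[OF p f(1) A] f(3) by (simp add: RM(2)[OF f'] RN(2)[OF y])
    ultimately show "\<exists>f\<in>Lp_functions p ?M.
       (AE x in ?N. g x * f x = y x) \<and> Lp_seminorm p ?M f \<le> c * Lp_seminorm q ?N y"
      using f' by blast
  next
    fix c :: real and y assume c: "0 < c" and y: "y \<in> Lp_functions q N"
      and sur: "\<forall>y\<in>Lp_functions q ?N. \<exists>f\<in>Lp_functions p ?M.
       (AE x in ?N. g x * f x = y x) \<and> Lp_seminorm p ?M f \<le> c * Lp_seminorm q ?N y"
    have y': "y \<in> Lp_functions q ?N" using RN(1) cut(1)[OF q y AN] by blast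
    then obtain f where f: "f \<in> Lp_functions p ?M" "AE x in ?N. g x * f x = y x"
      "Lp_seminorm p ?M f \<le> c * Lp_seminorm q ?N y"
      using sur by blast
    have "AE x in N. x \<in> A \<longrightarrow> g x * f x = y x"
      using f(2) AN by (simp add: AE_restrict_space_iff)
    with co have "AE x in N. g x * (indicator A x * f x) = y x"
      by eventually_elim simp
    moreover have "Lp_seminorm p M (\<lambda>x. indicator A x * f x) \<le> c * Lp_seminorm q N y"
    proof -
      have "Lp_seminorm p M (\<lambda>x. indicator A x * f x) \<le> c * Lp_seminorm q N (\<lambda>x. indicator A x * y x)"
        using f(3) by (simp add: RM(2)[OF f(1)] RN(2)[OF y'])
      also have "\<dots> \<le> c * Lp_seminorm q N y"
        using cut(2)[OF q y AN] c by simp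
      finally show ?thesis .
    qed
    ultimately show "\<exists>f\<in>Lp_functions p M.
       (AE x in N. g x * f x = y x) \<and> Lp_seminorm p M f \<le> c * Lp_seminorm q N y"
      by (intro bexI[OF _ RM(1)[THEN iffD1, OF f(1)]] conjI)
  qed
qed

section \<open>Atoms\<close>

lemma (in sigma_finite_measure) finite_pos_subset:
  assumes A: "A \<in> sets M" "0 < emeasure M A"
  obtains B where "B \<in> sets M" "B \<subseteq> A" "0 < emeasure M B" "emeasure M B < \<infinity>"
proof (cases "emeasure M A = \<infinity>")
  case True
  show ?thesis
    using approx_PInf_emeasure_with_finite[OF A(1) True, of 0] that by (metis ennreal_0)
next
  case False
  then show ?thesis using that[of A] A by (simp add: less_top)
qed

text \<open>
  An atom of a \<open>\<sigma>\<close>-finite measure has finite measure, as it agrees up to a null set with each of its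
  subsets of finite positive measure.  A set of positive measure meets some atom in positive measure
  and therefore contains this atom up to a null set; so the smallest measure of an atom bounds all
  nonzero values of the measure from below.
\<close>

lemma
  assumes "sigma_finite_measure M" and "finitely_many_atoms M"
  shows finitely_many_atoms_finite_measure: "finite_measure M"
    and finitely_many_atoms_gap:
      "\<exists>m>0. \<forall>E\<in>sets M. 0 < emeasure M E \<longrightarrow> ennreal m \<le> emeasure M E"
proof -
  interpret sigma_finite_measure M by fact
  obtain \<A> where \<A>: "finite \<A>" "disjoint \<A>" "\<And>A. A \<in> \<A> \<Longrightarrow> is_atom M A"
    "emeasure M (space M - \<Union>\<A>) = 0"
    using assms(2) by (auto simp: finitely_many_atoms_def)
  have sets: "A \<in> sets M" and pos: "0 < emeasure M A" if "A \<in> \<A>" for A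
    using \<A>(3)[OF that] by (auto simp: is_atom_def)
  have Un: "\<Union>\<A> \<in> sets M" using \<A>(1) sets by blast
  have fin: "emeasure M A < \<infinity>" if "A \<in> \<A>" for A
  proof -
    from finite_pos_subset[OF sets[OF that] pos[OF that]]
    obtain B where B: "B \<in> sets M" "B \<subseteq> A" "0 < emeasure M B" "emeasure M B < \<infinity>" .
    have "emeasure M (A - B) = 0" using \<A>(3)[OF that] B by (auto simp: is_atom_def)
    moreover have "emeasure M A \<le> emeasure M B + emeasure M (A - B)"
      using emeasure_subadditive[of B M "A - B"] B sets[OF that] by (simp add: Un_absorb1)
    ultimately show ?thesis using B(4) by (metis add_0_right order.strict_trans1)
  qed
  have rest: "space M - \<Union>\<A> \<in> null_sets M" using \<A>(4) Un by auto
  have cover: "emeasure M E \<le> (\<Sum>A\<in>\<A>. emeasure M (E \<inter> A))" if E: "E \<in> sets M" for E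
  proof -
    have "emeasure M E = emeasure M (E \<inter> \<Union>\<A>)"
    proof (rule emeasure_eq_AE)
      show "AE x in M. (x \<in> E) = (x \<in> E \<inter> \<Union>\<A>)"
        using AE_not_in[OF rest] AE_space by eventually_elim auto
    qed (use E Un in auto)
    also have "\<dots> = emeasure M (\<Union>A\<in>\<A>. E \<inter> A)" by (rule arg_cong) auto
    also have "\<dots> \<le> (\<Sum>A\<in>\<A>. emeasure M (E \<inter> A))"
      by (rule emeasure_subadditive_finite) (use \<A>(1) sets E in auto)
    finally show ?thesis .
  qed
  have "emeasure M (space M) \<le> (\<Sum>A\<in>\<A>. emeasure M (space M \<inter> A))"
    by (rule cover) simp
  also have "\<dots> < \<infinity>"
    using \<A>(1) fin sets by (simp add: sets.Int_space_eq1)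
  finally show "finite_measure M" by (intro finite_measureI) simp
  define m where "m = Min (insert 1 (measure M ` \<A>))"
  have m: "0 < m" "\<And>A. A \<in> \<A> \<Longrightarrow> m \<le> measure M A"
    using \<A>(1) pos fin by (auto simp: m_def measure_def enn2real_positive_iff)
  have gap: "ennreal m \<le> emeasure M E" if E: "E \<in> sets M" "0 < emeasure M E" for E
  proof -
    obtain A where A: "A \<in> \<A>" "emeasure M (E \<inter> A) \<noteq> 0"
    proof (rule ccontr)
      assume "\<not> thesis"
      then have "\<And>A. A \<in> \<A> \<Longrightarrow> emeasure M (E \<inter> A) = 0" using that by blast
      then have "(\<Sum>A\<in>\<A>. emeasure M (E \<inter> A)) = 0" by simp
      with cover[OF E(1)] E(2) show False by simp
    qed
    have "emeasure M (A - E) = 0"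
    proof -
      have "A - E \<inter> A = A - E" by auto
      moreover have "E \<inter> A \<in> sets M" using E(1) sets[OF A(1)] by simp
      ultimately show ?thesis
        using \<A>(3)[OF A(1)] A(2) unfolding is_atom_def by (metis Int_lower2)
    qed
    moreover have "emeasure M A \<le> emeasure M E + emeasure M (A - E)"
    proof -
      have "emeasure M A \<le> emeasure M (E \<union> (A - E))"
        using E sets[OF A(1)] by (intro emeasure_mono) auto
      also have "\<dots> \<le> emeasure M E + emeasure M (A - E)"
        using E sets[OF A(1)] by (intro emeasure_subadditive) auto
      finally show ?thesis .
    qed
    ultimately have "emeasure M A \<le> emeasure M E" by simp
    moreover have "ennreal m \<le> emeasure M A"
      using m(2)[OF A(1)] fin[OF A(1)]
      by (metis emeasure_eq_ennreal_measure ennreal_leI infinity_ennreal_def order_less_irrefl)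
    ultimately show ?thesis by (rule order_trans[rotated])
  qed
  with m(1) show "\<exists>m>0. \<forall>E\<in>sets M. 0 < emeasure M E \<longrightarrow> ennreal m \<le> emeasure M E"
    by blast
qed

text \<open>
  A family can always be enlarged: if all its members are atoms, their union has a complement of
  positive measure, and this complement is added; otherwise a member that is not an atom is split.
\<close>

lemma not_finitely_many_atoms_disjoint_family:
  assumes not: "\<not> finitely_many_atoms M"
  shows "\<exists>\<B>. finite \<B> \<and> card \<B> = N \<and> disjoint \<B> \<and> (\<forall>B\<in>\<B>. B \<in> sets M \<and> 0 < emeasure M B)"
proof (induction N)
  case 0
  show ?case by (intro exI[of _ "{}"]) (auto simp: disjoint_def)
next
  case (Suc N)
  then obtain \<B> where \<B>: "finite \<B>" "card \<B> = N" "disjoint \<B>"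
    and sets: "\<And>B. B \<in> \<B> \<Longrightarrow> B \<in> sets M" and pos: "\<And>B. B \<in> \<B> \<Longrightarrow> 0 < emeasure M B" by blast
  show ?case
  proof (cases "\<forall>B\<in>\<B>. is_atom M B")
    case True
    let ?C = "space M - \<Union>\<B>"
    have C: "?C \<in> sets M" using \<B>(1) sets by blast
    have C': "0 < emeasure M ?C"
      using not True \<B> by (auto simp: finitely_many_atoms_def zero_less_iff_neq_zero)
    have "?C \<notin> \<B>"
    proof
      assume "?C \<in> \<B>"
      then have "?C = {}" by blast
      with C' show False by simp
    qed
    moreover have "disjoint (insert ?C \<B>)"
      using \<B>(3) by (auto simp: disjoint_def)
    ultimately show ?thesis
      using \<B> C C' sets pos by (intro exI[of _ "insert ?C \<B>"]) auto
  next
    case False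
    then obtain B where B: "B \<in> \<B>" "\<not> is_atom M B" by blast
    then obtain E where E: "E \<in> sets M" "E \<subseteq> B" "emeasure M E \<noteq> 0" "emeasure M (B - E) \<noteq> 0"
      using sets[OF B(1)] pos[OF B(1)] by (auto simp: is_atom_def)
    have ne: "E \<noteq> {}" "B - E \<noteq> {}" using E by force+
    have apart: "x \<notin> B" if "x \<in> B'" "B' \<in> \<B> - {B}" for x B'
      using \<B>(3) that B(1) by (auto simp: disjoint_def)
    have notin: "E \<notin> \<B> - {B}" "B - E \<notin> \<B> - {B}" "E \<noteq> B - E"
      using apart ne E(2) by blast+
    have "card (insert E (insert (B - E) (\<B> - {B}))) = Suc N"
    proof -
      have "card (\<B> - {B}) = N - 1" "0 < N"
        using \<B> B(1) by (auto simp: card_gt_0_iff)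
      then show ?thesis using notin \<B>(1) by auto
    qed
    moreover have "disjoint (insert E (insert (B - E) (\<B> - {B})))"
    proof (rule disjointI)
      fix a b assume ab: "a \<in> insert E (insert (B - E) (\<B> - {B}))"
        "b \<in> insert E (insert (B - E) (\<B> - {B}))" "a \<noteq> b"
      have "b \<inter> a = {}" if "b \<in> \<B> - {B}" "a \<in> {E, B - E}" for a b
        using apart[OF _ that(1)] that(2) E(2) by blast
      moreover have "a \<inter> b = {}" if "a \<in> \<B> - {B}" "b \<in> \<B> - {B}"
        using \<B>(3) that ab(3) by (auto simp: disjoint_def)
      ultimately show "a \<inter> b = {}" using ab by blast
    qed
    ultimately show ?thesis
      using \<B>(1) sets[OF B(1)] E sets pos
      by (intro exI[of _ "insert E (insert (B - E) (\<B> - {B}))"]) (auto simp: zero_less_iff_neq_zero)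
  qed
qed

text \<open>
  Since nonzero measures of sets are at least some \<open>m > 0\<close>, Chebyshev's inequality bounds \<open>\<bar>y\<bar>\<close> almost
  everywhere by a multiple of its \<open>L\<^sub>q\<close> seminorm; bounded functions are in \<open>L\<^sub>p\<close> because the measure is
  finite.
\<close>

lemma finitely_many_atoms_Lp_inclusion:
  assumes "sigma_finite_measure M" "finitely_many_atoms M" and p: "1 \<le> p" and q: "1 \<le> q"
  obtains K where "0 < K" "\<And>y. y \<in> Lp_functions q M \<Longrightarrow>
    y \<in> Lp_functions p M \<and> Lp_seminorm p M y \<le> K * Lp_seminorm q M y"
proof -
  obtain m :: real where m: "0 < m"
    "\<And>E. E \<in> sets M \<Longrightarrow> 0 < emeasure M E \<Longrightarrow> ennreal m \<le> emeasure M E"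
    using finitely_many_atoms_gap[OF assms(1,2)] by metis
  interpret finite_measure M by (rule finitely_many_atoms_finite_measure[OF assms(1,2)])
  \<comment> \<open>The factor \<open>2\<close> makes the contradiction below strict.\<close>
  define C where "C = 2 * m powr - enn2real (1 / q)"
  have C: "0 < C" using m(1) by (simp add: C_def)
  have bound: "AE x in M. norm (y x) \<le> C * Lp_seminorm q M y" if y: "y \<in> Lp_functions q M" for y
  proof (cases "Lp_seminorm q M y = 0")
    case True
    then show ?thesis using Lp_seminorm_eq_0D[OF q y] by simp
  next
    case False
    then have s: "0 < Lp_seminorm q M y" using Lp_seminorm_nonneg[of q M y] by linarith
    have [measurable]: "y \<in> borel_measurable M" by (rule Lp_functions_measurable[OF y])
    let ?t = "C * Lp_seminorm q M y"
    let ?E = "{x\<in>space M. ?t < norm (y x)}"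
    have t: "0 < ?t" using C s by simp
    have "emeasure M ?E = 0"
    proof (rule ccontr)
      assume "emeasure M ?E \<noteq> 0"
      then have pos: "0 < emeasure M ?E" by (simp add: zero_less_iff_neq_zero)
      have "ennreal m \<le> ennreal (measure M ?E)"
        using m(2)[OF _ pos] by (simp add: emeasure_eq_measure)
      then have "m \<le> measure M ?E" by simp
      then have "m powr enn2real (1 / q) \<le> measure M ?E powr enn2real (1 / q)"
        using m(1) by (intro powr_mono2) auto
      also have "\<dots> = Lp_seminorm q M (indicator ?E)"
        using Lp_seminorm_indicator(2)[OF q _ pos] by (simp add: emeasure_eq_measure)
      also have "\<dots> \<le> inverse ?t * Lp_seminorm q M y"
        using t by (intro Lp_mono(2)[OF q _ y]) (auto simp: indicator_def field_simps)
      also have "\<dots> = m powr enn2real (1 / q) / 2"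
        using s m(1) by (simp add: C_def powr_minus field_simps)
      finally show False using m(1) by simp
    qed
    then have "?E \<in> null_sets M" by auto
    from AE_not_in[OF this] AE_space show ?thesis by eventually_elim auto
  qed
  have one: "(\<lambda>x. 1) \<in> Lp_functions p M"
  proof (rule Lp_mono(1)[OF p])
    show "(indicator (space M) :: 'a \<Rightarrow> complex) \<in> Lp_functions p M"
      by (intro Lp_bounded_finite_support[OF p, of _ _ "space M" 1]) (auto simp: less_top[symmetric])
    show "AE x in M. norm (1::complex) \<le> 1 * norm (indicator (space M) x :: complex)"
      using AE_space by eventually_elim simp
  qed auto
  define K where "K = C * Lp_seminorm p M (\<lambda>x. 1) + 1"
  show ?thesis
  proof (rule that[of K])
    show "0 < K"
      using C Lp_seminorm_nonneg[of p M "\<lambda>x. 1"] by (simp add: K_def add_nonneg_pos)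
    fix y assume y: "y \<in> Lp_functions q M"
    have s: "0 \<le> Lp_seminorm q M y" by (rule Lp_seminorm_nonneg)
    have le: "AE x in M. norm (y x) \<le> C * Lp_seminorm q M y * norm (1::complex)"
      using bound[OF y] by simp
    have nn: "0 \<le> C * Lp_seminorm q M y" using C s by simp
    have "y \<in> Lp_functions p M"
      by (rule Lp_mono(1)[OF p Lp_functions_measurable[OF y] one nn le])
    moreover have "Lp_seminorm p M y \<le> C * Lp_seminorm q M y * Lp_seminorm p M (\<lambda>x. 1)"
      by (rule Lp_mono(2)[OF p Lp_functions_measurable[OF y] one nn le])
    then have "Lp_seminorm p M y \<le> K * Lp_seminorm q M y"
      using s by (simp add: K_def algebra_simps)
    ultimately show "y \<in> Lp_functions p M \<and> Lp_seminorm p M y \<le> K * Lp_seminorm q M y" ..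
  qed
qed

text \<open>
  The sets where \<open>h < 1 / (n + 1)\<close> decrease to a null set, so their measures tend to zero; as small
  nonzero measures do not occur, one of these sets is already null.
\<close>

lemma finitely_many_atoms_bounded_below:
  fixes h :: "'a \<Rightarrow> real"
  assumes "sigma_finite_measure M" "finitely_many_atoms M"
    and h[measurable]: "h \<in> borel_measurable M" and pos: "AE x in M. 0 < h x"
  shows "\<exists>c>0. AE x in M. c \<le> h x"
proof -
  obtain m :: real where m: "0 < m"
    "\<And>E. E \<in> sets M \<Longrightarrow> 0 < emeasure M E \<Longrightarrow> ennreal m \<le> emeasure M E"
    using finitely_many_atoms_gap[OF assms(1,2)] by metis
  interpret finite_measure M by (rule finitely_many_atoms_finite_measure[OF assms(1,2)])
  define E where "E n = {x\<in>space M. h x < 1 / real (Suc n)}" for n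
  have [measurable]: "E n \<in> sets M" for n unfolding E_def by measurable
  have "(\<lambda>n. measure M (E n)) \<longlonglongrightarrow> measure M (\<Inter>n. E n)"
  proof (rule finite_Lim_measure_decseq)
    have "1 / real (Suc n) \<le> 1 / real (Suc k)" if "k \<le> n" for k n
      using that by (simp add: frac_le)
    then show "decseq E" by (fastforce simp: decseq_def E_def)
  qed auto
  also have "measure M (\<Inter>n. E n) = 0"
  proof -
    have "AE x in M. x \<notin> (\<Inter>n. E n)"
      using pos
    proof eventually_elim
      case (elim x)
      then obtain n where "1 / real (Suc n) < h x"
        using reals_Archimedean[of "h x"] by (auto simp: inverse_eq_divide)
      then have "x \<notin> E n" by (simp add: E_def)
      then show ?case by blast
    qed
    then show ?thesis
      by (subst (asm) AE_iff_null_sets[symmetric]) (auto intro: measure_eq_0_null_sets)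
  qed
  finally have "\<forall>\<^sub>F n in sequentially. measure M (E n) < m"
    using m(1) by (rule order_tendstoD)
  then obtain n where n: "measure M (E n) < m" by (auto simp: eventually_sequentially)
  have "emeasure M (E n) = 0"
  proof (rule ccontr)
    assume "emeasure M (E n) \<noteq> 0"
    then have "ennreal m \<le> ennreal (measure M (E n))"
      using m(2)[of "E n"] by (simp add: emeasure_eq_measure zero_less_iff_neq_zero)
    then show False using n by simp
  qed
  then have "E n \<in> null_sets M" by auto
  from AE_not_in[OF this] AE_space have "AE x in M. 1 / real (Suc n) \<le> h x"
    by eventually_elim (auto simp: E_def)
  then show ?thesis by (intro exI[of _ "1 / real (Suc n)"]) simp
qed

section \<open>The criterion for topological surjectivity\<close>

text \<open>
  A bounded multiplication operator from \<open>L\<^sub>p(M)\<close> to \<open>L\<^sub>q(N)\<close>, stated for representatives.  The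
  absolutely continuous part of \<open>M\<close> lives on \<open>A\<close>, where \<open>M\<close> has the density \<open>\<rho>\<close>; the
  singular part is confined to the complement of \<open>A\<close>, which is null for \<open>N\<close>.
\<close>

locale Lp_multiplication =
  fixes M N :: "'a measure" and A :: "'a set" and \<rho> :: "'a \<Rightarrow> real"
    and p q :: ennreal and g :: "'a \<Rightarrow> complex" and K :: real
  assumes sigma_M: "sigma_finite_measure M" and sigma_N: "sigma_finite_measure N"
    and sets_eq: "sets M = sets N" and p: "1 \<le> p" and q: "1 \<le> q"
    and A: "A \<in> sets N" and AE_A: "AE x in N. x \<in> A"
    and \<rho>[measurable]: "\<rho> \<in> borel_measurable N"
    and ac: "\<And>E. E \<in> sets N \<Longrightarrow> E \<subseteq> A \<Longrightarrow>
      emeasure M E = emeasure (density N (\<lambda>x. ennreal (\<rho> x))) E"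
    and g[measurable]: "g \<in> borel_measurable N"
    and null: "\<And>E. E \<in> null_sets M \<Longrightarrow> AE x in N. x \<in> E \<longrightarrow> g x = 0"
    and maps: "\<And>f. f \<in> Lp_functions p M \<Longrightarrow> (\<lambda>x. g x * f x) \<in> Lp_functions q N"
    and bounded: "\<And>f. f \<in> Lp_functions p M \<Longrightarrow>
      Lp_seminorm q N (\<lambda>x. g x * f x) \<le> K * Lp_seminorm p M f"
    and K: "0 < K"
begin

abbreviation D :: "'a measure" where "D \<equiv> density N (\<lambda>x. ennreal (\<rho> x))"

lemma measurable_M: "borel_measurable M = (borel_measurable N :: ('a \<Rightarrow> complex) set)"
  using sets_eq by (simp cong: measurable_cong_sets)

lemma A_in_M: "A \<in> sets M" using A sets_eq by simp

text \<open>
  The part of \<open>A\<close> where \<open>\<rho>\<close> vanishes is null for \<open>M\<close>, so well-definedness makes \<open>g\<close> vanish there.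
\<close>

lemma g_zero_off_density: "AE x in N. \<rho> x \<le> 0 \<longrightarrow> g x = 0"
proof -
  let ?E = "{x\<in>space N. \<rho> x \<le> 0} \<inter> A"
  have E: "?E \<in> sets N" using A by measurable
  have "?E \<in> null_sets D"
    using E by (subst null_sets_density_iff) (auto simp: ennreal_neg)
  then have "?E \<in> null_sets M" using E ac[OF E] sets_eq by (auto simp: null_sets_def)
  from null[OF this] AE_A AE_space show ?thesis by eventually_elim auto
qed

lemma null_M_of_null_N:
  assumes "E \<in> null_sets N"
  shows "E \<inter> A \<in> null_sets M"
proof -
  have EA: "E \<inter> A \<in> null_sets N" using assms A by (rule null_set_Int2)
  have "AE x in N. x \<in> E \<inter> A \<longrightarrow> ennreal (\<rho> x) = 0"
    using AE_not_in[OF EA] by eventually_elim blast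
  with EA have "E \<inter> A \<in> null_sets D"
    by (subst null_sets_density_iff) (auto dest: null_setsD2)
  then show ?thesis
    using ac[OF null_setsD2[OF EA] Int_lower2] sets_eq by (simp add: null_sets_def)
qed

lemma restrict_M_eq_restrict_D: "restrict_space M A = restrict_space D A"
proof (rule measure_eqI)
  show "sets (restrict_space M A) = sets (restrict_space D A)"
    using sets_eq by (intro sets_restrict_space_cong) simp
  fix E assume "E \<in> sets (restrict_space M A)"
  then have "E \<in> sets N" "E \<subseteq> A"
    using A_in_M sets_eq by (auto simp: sets_restrict_space_iff)
  then show "emeasure (restrict_space M A) E = emeasure (restrict_space D A) E"
    using ac[of E] A A_in_M by (simp add: emeasure_restrict_space)
qed

text \<open>
  On \<open>A\<close> the measures \<open>M\<close> and \<open>\<rho> \<cdot> N\<close> coincide, so the isometry of \<open>Lp_density\<close> is available for \<open>M\<close>;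
  it transfers estimates to the single measure \<open>N\<close>.
\<close>

lemma Lp_weight:
  assumes pos: "AE x in N. 0 < \<rho> x" and f[measurable]: "f \<in> borel_measurable N"
  shows "(\<lambda>x. indicator A x * f x) \<in> Lp_functions p M \<longleftrightarrow>
      (\<lambda>x. f x * complex_of_real (\<rho> x powr enn2real (1 / p))) \<in> Lp_functions p N"
    "(\<lambda>x. indicator A x * f x) \<in> Lp_functions p M \<Longrightarrow>
      Lp_seminorm p M (\<lambda>x. indicator A x * f x)
        = Lp_seminorm p N (\<lambda>x. f x * complex_of_real (\<rho> x powr enn2real (1 / p)))"
proof -
  note [measurable] = A
  let ?Af = "\<lambda>x. indicator A x * f x"
  let ?F = "\<lambda>x. f x * complex_of_real (\<rho> x powr enn2real (1 / p))"
  let ?AF = "\<lambda>x. ?Af x * complex_of_real (\<rho> x powr enn2real (1 / p))"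
  have AD: "A \<in> sets D" using A by simp
  have meas: "?Af \<in> borel_measurable N" "?F \<in> borel_measurable N" "?AF \<in> borel_measurable N"
    by measurable
  have eq1: "AE x in N. norm (?AF x) = norm (?F x)"
    using AE_A by eventually_elim simp
  then have eq2: "AE x in N. norm (?F x) = norm (?AF x)"
    by eventually_elim (rule sym)
  note RM = Lp_restrict_space[OF p A_in_M, of f]
    and RD = Lp_restrict_space[OF p AD, of f, folded restrict_M_eq_restrict_D]
    and W = Lp_density[OF p meas(1) \<rho> pos]
  have iff_D: "?Af \<in> Lp_functions p M \<longleftrightarrow> ?Af \<in> Lp_functions p D"
    using RM(1) RD(1) by (rule trans[OF sym])
  have iff_AF: "?AF \<in> Lp_functions p N \<longleftrightarrow> ?F \<in> Lp_functions p N"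
  proof
    show "?F \<in> Lp_functions p N" if "?AF \<in> Lp_functions p N"
      by (rule Lp_norm_cong(1)[OF p meas(2) that eq2])
    show "?AF \<in> Lp_functions p N" if "?F \<in> Lp_functions p N"
      by (rule Lp_norm_cong(1)[OF p meas(3) that eq1])
  qed
  show iff: "?Af \<in> Lp_functions p M \<longleftrightarrow> ?F \<in> Lp_functions p N"
    unfolding iff_D W(1) by (rule iff_AF)
  assume Af: "?Af \<in> Lp_functions p M"
  have "Lp_seminorm p M ?Af = Lp_seminorm p (restrict_space M A) f"
    by (rule RM(2)[OF RM(1)[THEN iffD2, OF Af], symmetric])
  also have "\<dots> = Lp_seminorm p D ?Af"
    by (rule RD(2)[OF RM(1)[THEN iffD2, OF Af]])
  also have "\<dots> = Lp_seminorm p N ?AF"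
    by (rule W(2)[OF iff_D[THEN iffD1, OF Af]])
  also have "\<dots> = Lp_seminorm p N ?F"
    by (rule Lp_norm_cong(2)[OF p meas(3) iff[THEN iffD1, OF Af] eq1])
  finally show "Lp_seminorm p M ?Af = Lp_seminorm p N ?F" .
qed

text \<open>
  Topological surjectivity in terms of representatives, with its constant made explicit.
\<close>

definition lifts_with_constant :: "real \<Rightarrow> bool" where
  "lifts_with_constant c \<longleftrightarrow> 0 < c \<and> (\<forall>y\<in>Lp_functions q N. \<exists>f\<in>Lp_functions p M.
     (AE x in N. g x * f x = y x) \<and> Lp_seminorm p M f \<le> c * Lp_seminorm q N y)"

lemma lifts_with_constantD:
  assumes "lifts_with_constant c"
  shows "0 < c" "y \<in> Lp_functions q N \<Longrightarrow> \<exists>f\<in>Lp_functions p M.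
     (AE x in N. g x * f x = y x) \<and> Lp_seminorm p M f \<le> c * Lp_seminorm q N y"
  using assms by (simp_all add: lifts_with_constant_def)

text \<open>
  An indicator of a set on which \<open>g\<close> vanishes would have no preimage.
\<close>

lemma lifts_imp_nonzero:
  assumes "lifts_with_constant c"
  shows "AE x in N. g x \<noteq> 0" "AE x in N. 0 < \<rho> x"
proof -
  interpret N: sigma_finite_measure N by (rule sigma_N)
  let ?Z = "{x\<in>space N. g x = 0}"
  have Z: "?Z \<in> sets N" by measurable
  have "emeasure N ?Z = 0"
  proof (rule ccontr)
    assume "emeasure N ?Z \<noteq> 0"
    then have "0 < emeasure N ?Z" by (simp add: zero_less_iff_neq_zero)
    from N.finite_pos_subset[OF Z this] obtain B where
      B: "B \<in> sets N" "B \<subseteq> ?Z" "0 < emeasure N B" "emeasure N B < \<infinity>" .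
    obtain f where "AE x in N. g x * f x = indicator B x"
      using lifts_with_constantD(2)[OF assms Lp_seminorm_indicator(1)[OF q B(1,3,4)]] by blast
    then have "AE x in N. x \<notin> B"
      by eventually_elim (use B(2) in \<open>auto simp: indicator_def split: if_splits\<close>)
    then show False using B(1,3) by (simp add: AE_iff_null_sets[symmetric] null_sets_def)
  qed
  then have "?Z \<in> null_sets N" using Z by auto
  from AE_not_in[OF this] AE_space show nz: "AE x in N. g x \<noteq> 0"
    by eventually_elim auto
  from this g_zero_off_density show "AE x in N. 0 < \<rho> x"
    by eventually_elim force
qed

text \<open>
  The preimage of \<open>g f\<close> provided by surjectivity coincides with \<open>f\<close> on \<open>A\<close>, as \<open>g \<noteq> 0\<close>; so the
  lifting constant applies to \<open>f\<close> itself.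
\<close>

lemma lifts_imp_bounded_below:
  assumes lifts: "lifts_with_constant c" and f: "f \<in> Lp_functions p M"
    and supp: "\<And>x. x \<notin> A \<Longrightarrow> f x = 0"
  shows "Lp_seminorm p M f \<le> c * Lp_seminorm q N (\<lambda>x. g x * f x)"
proof -
  obtain f' where f': "f' \<in> Lp_functions p M" "AE x in N. g x * f' x = g x * f x"
    "Lp_seminorm p M f' \<le> c * Lp_seminorm q N (\<lambda>x. g x * f x)"
    using lifts_with_constantD(2)[OF lifts maps[OF f]] by blast
  have [measurable]: "f \<in> borel_measurable N" "f' \<in> borel_measurable N"
    using Lp_functions_measurable[OF f] Lp_functions_measurable[OF f'(1)]
    unfolding measurable_M by auto
  have "AE x in N. f' x = f x"
    using f'(2) lifts_imp_nonzero(1)[OF lifts] by eventually_elim simp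
  then have "{x\<in>space N. f' x \<noteq> f x} \<in> null_sets N"
    by (subst (asm) AE_iff_null) auto
  from AE_not_in[OF null_M_of_null_N[OF this]] AE_space
  have "AE x in M. norm (f x) \<le> 1 * norm (f' x)"
    by eventually_elim (use supp sets_eq_imp_space_eq[OF sets_eq] in auto)
  from Lp_mono(2)[OF p Lp_functions_measurable[OF f] f'(1) _ this]
  show ?thesis using f'(3) by simp
qed

lemma null_N_iff_null_M:
  assumes pos: "AE x in N. 0 < \<rho> x" and E: "E \<in> sets N" "E \<subseteq> A"
  shows "emeasure M E = 0 \<longleftrightarrow> emeasure N E = 0"
proof -
  have "emeasure M E = 0 \<longleftrightarrow> (AE x in D. x \<notin> E)"
    using ac[OF E] E by (simp add: AE_iff_null_sets[symmetric] null_sets_def)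
  also have "\<dots> \<longleftrightarrow> (AE x in N. 0 < ennreal (\<rho> x) \<longrightarrow> x \<notin> E)"
    by (rule AE_density) simp
  also have "\<dots> \<longleftrightarrow> (AE x in N. x \<notin> E)"
    by (rule eventually_subst) (use pos in \<open>eventually_elim, simp\<close>)
  also have "\<dots> \<longleftrightarrow> emeasure N E = 0"
    using E by (simp add: AE_iff_null_sets[symmetric] null_sets_def)
  finally show ?thesis .
qed

text \<open>
  Supplies the test sets, whose indicators have finite nonzero norm for both measures.
\<close>

lemma pos_subset_finite_for_both:
  assumes pos: "AE x in N. 0 < \<rho> x" and E: "E \<in> sets N" "0 < emeasure N E"
  obtains B where "B \<in> sets N" "B \<subseteq> E \<inter> A" "0 < emeasure N B" "emeasure N B < \<infinity>"
    "0 < emeasure M B" "emeasure M B < \<infinity>"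
proof -
  interpret M: sigma_finite_measure M by (rule sigma_M)
  interpret N: sigma_finite_measure N by (rule sigma_N)
  have "AE x in N. (x \<in> E \<inter> A) = (x \<in> E)"
    using AE_A by eventually_elim simp
  then have "emeasure N (E \<inter> A) = emeasure N E"
    using E A by (intro emeasure_eq_AE) auto
  then have "0 < emeasure N (E \<inter> A)" "E \<inter> A \<in> sets N" using E A by auto
  from N.finite_pos_subset[OF this(2,1)] obtain C where
    C: "C \<in> sets N" "C \<subseteq> E \<inter> A" "0 < emeasure N C" "emeasure N C < \<infinity>" .
  have "C \<in> sets M" "0 < emeasure M C"
    using C null_N_iff_null_M[OF pos, of C] sets_eq by (auto simp: zero_less_iff_neq_zero)
  from M.finite_pos_subset[OF this] obtain B where
    B: "B \<in> sets M" "B \<subseteq> C" "0 < emeasure M B" "emeasure M B < \<infinity>" .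
  have "emeasure N B \<le> emeasure N C" using B C by (intro emeasure_mono) auto
  then have "emeasure N B < \<infinity>" using C(4) by (rule order.strict_trans1)
  moreover have "0 < emeasure N B"
    using B C null_N_iff_null_M[OF pos, of B] sets_eq by (auto simp: zero_less_iff_neq_zero)
  ultimately show ?thesis using that[of B] B C sets_eq by auto
qed

text \<open>
  If \<open>\<bar>g\<bar>\<close> were smaller on a set \<open>B\<close> of positive measure, the norm \<open>s\<close> of its indicator would satisfy
  \<open>s \<le> c \<cdot> s / (2 c) = s / 2\<close>.
\<close>

lemma lifts_imp_lower_bound_same_exponent:
  assumes lifts: "lifts_with_constant c" and "p = q"
  shows "AE x in N. 1 / (2 * c) * \<rho> x powr enn2real (1 / p) \<le> norm (g x)"
proof -
  have c: "0 < c" using lifts by (simp add: lifts_with_constant_def)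
  note pos = lifts_imp_nonzero(2)[OF lifts]
  define w where "w x = \<rho> x powr enn2real (1 / p)" for x
  have [measurable]: "w \<in> borel_measurable N" unfolding w_def by measurable
  let ?E = "{x\<in>space N. norm (g x) < 1 / (2 * c) * w x}"
  have E: "?E \<in> sets N" by measurable
  have "emeasure N ?E = 0"
  proof (rule ccontr)
    assume "emeasure N ?E \<noteq> 0"
    then have "0 < emeasure N ?E" by (simp add: zero_less_iff_neq_zero)
    from pos_subset_finite_for_both[OF pos E this] obtain B where
      B: "B \<in> sets N" "B \<subseteq> ?E \<inter> A" "0 < emeasure N B" "emeasure N B < \<infinity>"
        "0 < emeasure M B" "emeasure M B < \<infinity>" .
    note [measurable] = B(1)
    have BM: "B \<in> sets M" using B(1) sets_eq by simp
    have f: "(indicator B :: 'a \<Rightarrow> complex) \<in> Lp_functions p M"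
      by (rule Lp_seminorm_indicator(1)[OF p BM B(5,6)])
    define s where "s = Lp_seminorm p M (indicator B)"
    have "s \<le> c * Lp_seminorm p N (\<lambda>x. g x * indicator B x)"
      unfolding s_def using lifts_imp_bounded_below[OF lifts f] B(2) \<open>p = q\<close>
      by (auto simp: indicator_def)
    also have "Lp_seminorm p N (\<lambda>x. g x * indicator B x) \<le> s / (2 * c)"
    proof -
      have BA: "(\<lambda>x. indicator A x * indicator B x) = (indicator B :: 'a \<Rightarrow> complex)"
        using B(2) by (intro ext) (auto split: split_indicator)
      have F: "(\<lambda>x. indicator B x * complex_of_real (w x)) \<in> Lp_functions p N"
        "s = Lp_seminorm p N (\<lambda>x. indicator B x * complex_of_real (w x))"
        using Lp_weight[OF pos, of "indicator B"] f BA by (simp_all add: w_def s_def)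
      have "norm (g x * indicator B x) \<le> 1 / (2 * c) * norm (indicator B x * complex_of_real (w x))" for x
        using B(2) by (auto simp: indicator_def w_def)
      then have "Lp_seminorm p N (\<lambda>x. g x * indicator B x) \<le> 1 / (2 * c) * s"
        unfolding F(2) using c by (intro Lp_mono(2)[OF p _ F(1)]) auto
      then show ?thesis by simp
    qed
    finally have "s \<le> s / 2" using c by simp
    moreover have "0 < s"
      unfolding s_def by (rule Lp_seminorm_indicator(3)[OF p BM B(5,6)])
    ultimately show False by simp
  qed
  then have "?E \<in> null_sets N" using E by auto
  from AE_not_in[OF this] AE_space show ?thesis
    by eventually_elim (auto simp: w_def)
qed

text \<open>
  The sum of the normalised indicators of \<open>n\<close> disjoint sets has norm \<open>n\<^bsup>1/p\<^esup>\<close>.  Its image consists of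
  \<open>n\<close> disjoint pieces with norms between \<open>1 / c\<close> and \<open>K\<close>, so has norm comparable to \<open>n\<^bsup>1/q\<^esup>\<close>.  As the
  operator is bounded above and below, \<open>n\<^bsup>\<bar>1/p - 1/q\<bar>\<^esup>\<close> is bounded by \<open>c K\<close> for every \<open>n\<close> that occurs.
\<close>

lemma lifts_imp_finitely_many_atoms:
  assumes lifts: "lifts_with_constant c" and "p \<noteq> q"
  shows "finitely_many_atoms N"
proof (rule ccontr)
  assume no_atoms: "\<not> finitely_many_atoms N"
  have c: "0 < c" using lifts by (rule lifts_with_constantD)
  note pos = lifts_imp_nonzero(2)[OF lifts]
  define e d where "e = enn2real (1 / p)" and "d = enn2real (1 / q)"
  have compare: "real n powr e \<le> c * K * real n powr d" "real n powr d \<le> c * K * real n powr e"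
    if "0 < n" for n
  proof -
    obtain \<B>' where \<B>': "finite \<B>'" "card \<B>' = n" "disjoint \<B>'"
      "\<And>B. B \<in> \<B>' \<Longrightarrow> B \<in> sets N" "\<And>B. B \<in> \<B>' \<Longrightarrow> 0 < emeasure N B"
      using not_finitely_many_atoms_disjoint_family[OF no_atoms, of n] by blast
    have "\<exists>C. C \<in> sets N \<and> C \<subseteq> B \<inter> A \<and> 0 < emeasure M C \<and> emeasure M C < \<infinity>"
      if B: "B \<in> \<B>'" for B
      using pos_subset_finite_for_both[OF pos \<B>'(4)[OF B] \<B>'(5)[OF B]] by metis
    then obtain S where S: "\<And>B. B \<in> \<B>' \<Longrightarrow> S B \<in> sets N" "\<And>B. B \<in> \<B>' \<Longrightarrow> S B \<subseteq> B \<inter> A"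
      "\<And>B. B \<in> \<B>' \<Longrightarrow> 0 < emeasure M (S B)" "\<And>B. B \<in> \<B>' \<Longrightarrow> emeasure M (S B) < \<infinity>"
      by metis
    have S_ne: "S B \<noteq> {}" if "B \<in> \<B>'" for B
      using S(3)[OF that] by force
    have S_disj: "S B \<inter> S C = {}" if "B \<in> \<B>'" "C \<in> \<B>'" "B \<noteq> C" for B C
      using S(2)[OF that(1)] S(2)[OF that(2)] disjointD[OF \<B>'(3) that] by blast
    define \<B> where "\<B> = S ` \<B>'"
    have "inj_on S \<B>'"
      using S_ne S_disj by (intro inj_onI) (metis Int_absorb)
    then have \<B>: "finite \<B>" "card \<B> = n" "\<B> \<noteq> {}"
      using \<B>'(1,2) \<open>0 < n\<close> by (auto simp: \<B>_def card_image)
    have disj: "disjoint \<B>"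
      unfolding \<B>_def by (rule disjointI) (use S_disj in auto)
    have BN: "B \<in> sets N" and BM: "B \<in> sets M" and BA: "B \<subseteq> A"
      and Bpos: "0 < emeasure M B" and Bfin: "emeasure M B < \<infinity>" if "B \<in> \<B>" for B
      using that S sets_eq by (auto simp: \<B>_def)
    define a where "a B = Lp_seminorm p M (indicator B)" for B
    have a: "0 < a B" if "B \<in> \<B>" for B
      unfolding a_def by (rule Lp_seminorm_indicator(3)[OF p BM[OF that] Bpos[OF that] Bfin[OF that]])
    \<comment> \<open>The factors give each piece of \<open>f\<close> norm \<open>1\<close> in \<open>L\<^sub>p\<close>.\<close>
    define f where "f x = (\<Sum>B\<in>\<B>. complex_of_real (1 / a B) * indicator B x)" for x
    have f_on: "indicator B x * f x = complex_of_real (1 / a B) * indicator B x" if "B \<in> \<B>" for B x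
    proof (cases "x \<in> B")
      case True
      then have "x \<notin> C" if "C \<in> \<B> - {B}" for C
        using disj \<open>B \<in> \<B>\<close> that by (auto simp: disjoint_def)
      then have "(\<Sum>C\<in>\<B>-{B}. complex_of_real (1 / a C) * indicator C x) = 0"
        by (intro sum.neutral) auto
      then show ?thesis
        using True by (simp add: f_def sum.remove[OF \<B>(1) that])
    qed simp
    have f_off: "f x = 0" if "x \<notin> \<Union>\<B>" for x
      unfolding f_def using that by (intro sum.neutral) auto
    have f: "f \<in> Lp_functions p M"
    proof (rule Lp_bounded_finite_support[OF p])
      show "f \<in> borel_measurable M"
        unfolding f_def using BM by (intro borel_measurable_sum borel_measurable_times) auto
      show "\<Union>\<B> \<in> sets M" using \<B>(1) BM by blast
      have "emeasure M (\<Union>B\<in>\<B>. B) \<le> (\<Sum>B\<in>\<B>. emeasure M B)"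
        using \<B>(1) BM by (intro emeasure_subadditive_finite) auto
      also have "\<dots> < \<infinity>" using \<B>(1) Bfin by simp
      finally show "emeasure M (\<Union>\<B>) < \<infinity>" by simp
      show "norm (f x) \<le> (\<Sum>B\<in>\<B>. 1 / a B)" for x
        unfolding f_def using a
        by (intro sum_norm_le) (auto simp: norm_mult norm_divide indicator_def less_imp_le)
    qed (rule f_off)
    have piece: "(\<lambda>x. indicator B x * f x) \<in> Lp_functions p M"
      "Lp_seminorm p M (\<lambda>x. indicator B x * f x) = 1" if "B \<in> \<B>" for B
      using Lp_cmult[OF p Lp_seminorm_indicator(1)[OF p BM Bpos Bfin], OF that that that, of "complex_of_real (1 / a B)"]
        a[OF that] by (simp_all add: f_on[OF that] a_def[symmetric] norm_divide)
    have BM': "\<B> \<subseteq> sets M" and BN': "\<B> \<subseteq> sets N" using BM BN by auto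
    have norm_f: "Lp_seminorm p M f = real n powr e"
    proof (rule antisym)
      show "Lp_seminorm p M f \<le> real n powr e"
        using Lp_seminorm_disjoint(1)[OF p f \<B>(1) disj BM' f_off, of 1] piece(2)
        by (simp add: e_def \<B>(2))
      show "real n powr e \<le> Lp_seminorm p M f"
        using Lp_seminorm_disjoint(2)[OF p f \<B>(1) disj BM' f_off, of 1] piece(2) \<B>(3)
        by (simp add: e_def \<B>(2))
    qed
    have gf_off: "g x * f x = 0" if "x \<notin> \<Union>\<B>" for x using f_off[OF that] by simp
    have comm: "(\<lambda>x. indicator B x * (g x * f x)) = (\<lambda>x. g x * (indicator B x * f x))" for B
      by (auto simp: mult.left_commute)
    have up: "Lp_seminorm q N (\<lambda>x. indicator B x * (g x * f x)) \<le> K" if "B \<in> \<B>" for B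
      unfolding comm using bounded[OF piece(1)[OF that]] piece(2)[OF that] by simp
    have low: "1 / c \<le> Lp_seminorm q N (\<lambda>x. indicator B x * (g x * f x))" if "B \<in> \<B>" for B
    proof -
      have "1 \<le> c * Lp_seminorm q N (\<lambda>x. g x * (indicator B x * f x))"
        unfolding piece(2)[OF that, symmetric]
        by (rule lifts_imp_bounded_below[OF lifts piece(1)[OF that]])
          (use BA[OF that] in \<open>auto simp: indicator_def\<close>)
      then show ?thesis unfolding comm using c by (simp add: field_simps)
    qed
    have "Lp_seminorm q N (\<lambda>x. g x * f x) \<le> K * real n powr d"
      using Lp_seminorm_disjoint(1)[OF q maps[OF f] \<B>(1) disj BN' gf_off up less_imp_le[OF K]]
      by (simp add: d_def \<B>(2))
    moreover have "1 / c * real n powr d \<le> Lp_seminorm q N (\<lambda>x. g x * f x)"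
      using Lp_seminorm_disjoint(2)[OF q maps[OF f] \<B>(1) disj BN' gf_off low _ \<B>(3)] c
      by (simp add: d_def \<B>(2))
    moreover have "real n powr e \<le> c * Lp_seminorm q N (\<lambda>x. g x * f x)"
      unfolding norm_f[symmetric]
    proof (rule lifts_imp_bounded_below[OF lifts f])
      show "f x = 0" if "x \<notin> A" for x using f_off BA that by blast
    qed
    moreover have "Lp_seminorm q N (\<lambda>x. g x * f x) \<le> K * real n powr e"
      using bounded[OF f] norm_f by simp
    ultimately have "real n powr e \<le> c * (K * real n powr d)" "1 / c * real n powr d \<le> K * real n powr e"
      using c by (auto intro: order_trans mult_left_mono)
    then show "real n powr e \<le> c * K * real n powr d" "real n powr d \<le> c * K * real n powr e"
      using c by (simp_all add: field_simps)
  qed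
  have "\<bar>e - d\<bar> > 0"
    using enn2real_inverse_exponent_inj[OF p q \<open>p \<noteq> q\<close>] by (simp add: e_def d_def)
  have bounded_powers: "real n powr \<bar>e - d\<bar> \<le> c * K" if "0 < n" for n
    using compare[OF that] that by (cases "d \<le> e") (simp_all add: powr_diff divide_le_eq)
  \<comment> \<open>An integer so large that \<open>n\<^bsup>\<bar>e - d\<bar>\<^esup> > c K\<close>.\<close>
  define n where "n = Suc (nat \<lceil>(c * K) powr (1 / \<bar>e - d\<bar>)\<rceil>)"
  have "(c * K) powr (1 / \<bar>e - d\<bar>) < real n" unfolding n_def by linarith
  then have "((c * K) powr (1 / \<bar>e - d\<bar>)) powr \<bar>e - d\<bar> < real n powr \<bar>e - d\<bar>"
    using \<open>\<bar>e - d\<bar> > 0\<close> by (intro powr_less_mono2) auto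
  then show False
    using bounded_powers[of n] \<open>\<bar>e - d\<bar> > 0\<close> c K by (simp add: powr_powr n_def)
qed

lemma lower_bound_restrict_iff:
  assumes pos: "AE x in N. 0 < \<rho> x"
  shows "(AE x in restrict_space N A.
      c \<le> norm (g x * complex_of_real (\<rho> x powr - enn2real (1 / p)))) \<longleftrightarrow>
    (AE x in N. c * \<rho> x powr enn2real (1 / p) \<le> norm (g x))"
proof -
  have "A \<inter> space N \<in> sets N" using A by simp
  then have "(AE x in restrict_space N A.
      c \<le> norm (g x * complex_of_real (\<rho> x powr - enn2real (1 / p)))) \<longleftrightarrow>
    (AE x in N. x \<in> A \<longrightarrow> c \<le> norm (g x * complex_of_real (\<rho> x powr - enn2real (1 / p))))"
    by (rule AE_restrict_space_iff)
  also have "\<dots> \<longleftrightarrow> (AE x in N. c * \<rho> x powr enn2real (1 / p) \<le> norm (g x))"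
  proof (rule eventually_subst)
    show "AE x in N. (x \<in> A \<longrightarrow> c \<le> norm (g x * complex_of_real (\<rho> x powr - enn2real (1 / p))))
        = (c * \<rho> x powr enn2real (1 / p) \<le> norm (g x))"
      using AE_A pos
      by eventually_elim (simp add: norm_divide powr_minus_divide pos_le_divide_eq)
  qed
  finally show ?thesis .
qed

text \<open>
  The preimage of \<open>y\<close> is \<open>y / g\<close> on \<open>A\<close>, extended by zero: its weighted version
  \<open>y \<rho>\<^bsup>1/p\<^esup> / g\<close> is dominated by \<open>y / c\<close>.
\<close>

lemma lower_bound_imp_lifts:
  assumes pos: "AE x in N. 0 < \<rho> x" and c: "0 < c"
    and low: "AE x in N. c * \<rho> x powr enn2real (1 / p) \<le> norm (g x)"
    and C: "0 < C" and incl: "\<And>y. y \<in> Lp_functions q N \<Longrightarrow>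
      y \<in> Lp_functions p N \<and> Lp_seminorm p N y \<le> C * Lp_seminorm q N y"
  shows "lifts_with_constant (C / c)"
  unfolding lifts_with_constant_def
proof (intro conjI ballI)
  show "0 < C / c" using c C by simp
  fix y assume y: "y \<in> Lp_functions q N"
  note y_meas[measurable] = Lp_functions_measurable[OF y]
  define w where "w x = \<rho> x powr enn2real (1 / p)" for x
  have [measurable]: "w \<in> borel_measurable N" unfolding w_def by measurable
  let ?f = "\<lambda>x. y x / g x"
  have nz: "AE x in N. g x \<noteq> 0"
    using pos low
  proof eventually_elim
    case (elim x)
    then have "0 < c * \<rho> x powr enn2real (1 / p)" using c by simp
    with elim(2) show ?case by auto
  qed
  have "AE x in N. norm (?f x * complex_of_real (w x)) \<le> 1 / c * norm (y x)"
    using nz low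
  proof eventually_elim
    case (elim x)
    have "c * w x * norm (y x) \<le> norm (g x) * norm (y x)"
      using elim(2) by (intro mult_right_mono) (auto simp: w_def)
    then show ?case
      using c elim(1) by (simp add: norm_mult norm_divide w_def field_simps)
  qed
  note mono = Lp_mono[OF p _ incl[OF y, THEN conjunct1] _ this]
  have Fw: "(\<lambda>x. ?f x * complex_of_real (w x)) \<in> borel_measurable N" by measurable
  have c': "0 \<le> 1 / c" using c by simp
  have F: "(\<lambda>x. ?f x * complex_of_real (w x)) \<in> Lp_functions p N"
    "Lp_seminorm p N (\<lambda>x. ?f x * complex_of_real (w x)) \<le> 1 / c * Lp_seminorm p N y"
    by (rule mono[OF Fw c'])+
  have f_meas: "?f \<in> borel_measurable N" by measurable
  have f: "(\<lambda>x. indicator A x * ?f x) \<in> Lp_functions p M"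
    using Lp_weight(1)[OF pos f_meas] F(1) by (simp add: w_def)
  show "\<exists>f\<in>Lp_functions p M.
      (AE x in N. g x * f x = y x) \<and> Lp_seminorm p M f \<le> C / c * Lp_seminorm q N y"
  proof (intro bexI[OF _ f] conjI)
    show "AE x in N. g x * (indicator A x * ?f x) = y x"
      using nz AE_A by eventually_elim simp
    have "Lp_seminorm p M (\<lambda>x. indicator A x * ?f x) \<le> 1 / c * Lp_seminorm p N y"
      using Lp_weight(2)[OF pos f_meas f] F(2) by (simp add: w_def)
    also have "\<dots> \<le> 1 / c * (C * Lp_seminorm q N y)"
      using incl[OF y] c by (intro mult_left_mono) auto
    finally show "Lp_seminorm p M (\<lambda>x. indicator A x * ?f x) \<le> C / c * Lp_seminorm q N y"
      by simp
  qed
qed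

lemma lifts_iff:
  "(\<exists>c. lifts_with_constant c) \<longleftrightarrow>
    (AE x in N. 0 < \<rho> x) \<and>
    (\<exists>c>0. AE x in restrict_space N A.
       c \<le> norm (g x * complex_of_real (\<rho> x powr - enn2real (1 / p)))) \<and>
    (p \<noteq> q \<longrightarrow> finitely_many_atoms N)"
proof (intro iffI)
  assume "\<exists>c. lifts_with_constant c"
  then obtain c where lifts: "lifts_with_constant c" ..
  note nz = lifts_imp_nonzero[OF lifts]
  have "\<exists>c>0. AE x in N. c * \<rho> x powr enn2real (1 / p) \<le> norm (g x)"
  proof (cases "p = q")
    case True
    then show ?thesis
      using lifts_imp_lower_bound_same_exponent[OF lifts] lifts_with_constantD(1)[OF lifts]
      by (intro exI[of _ "1 / (2 * c)"]) simp
  next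
    case False
    have "\<exists>c>0. AE x in N. c \<le> norm (g x) / \<rho> x powr enn2real (1 / p)"
    proof (rule finitely_many_atoms_bounded_below[OF sigma_N])
      show "finitely_many_atoms N" by (rule lifts_imp_finitely_many_atoms[OF lifts False])
      show "AE x in N. 0 < norm (g x) / \<rho> x powr enn2real (1 / p)"
        using nz by eventually_elim simp
    qed measurable
    then obtain c' where c': "0 < c'" "AE x in N. c' \<le> norm (g x) / \<rho> x powr enn2real (1 / p)"
      by blast
    have "AE x in N. c' * \<rho> x powr enn2real (1 / p) \<le> norm (g x)"
      using c'(2) nz(2) by eventually_elim (simp add: field_simps)
    with c'(1) show ?thesis by blast
  qed
  then show "(AE x in N. 0 < \<rho> x) \<and>
    (\<exists>c>0. AE x in restrict_space N A.
       c \<le> norm (g x * complex_of_real (\<rho> x powr - enn2real (1 / p)))) \<and>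
    (p \<noteq> q \<longrightarrow> finitely_many_atoms N)"
    unfolding lower_bound_restrict_iff[OF nz(2)]
    by (intro conjI impI nz(2) lifts_imp_finitely_many_atoms[OF lifts])
next
  assume R: "(AE x in N. 0 < \<rho> x) \<and>
    (\<exists>c>0. AE x in restrict_space N A.
       c \<le> norm (g x * complex_of_real (\<rho> x powr - enn2real (1 / p)))) \<and>
    (p \<noteq> q \<longrightarrow> finitely_many_atoms N)"
  then have pos: "AE x in N. 0 < \<rho> x" by (rule conjunct1)
  from R[THEN conjunct2, THEN conjunct1, unfolded lower_bound_restrict_iff[OF pos]]
  obtain c where c: "0 < c" "AE x in N. c * \<rho> x powr enn2real (1 / p) \<le> norm (g x)"
    by (elim exE conjE)
  obtain C where "0 < C" "\<And>y. y \<in> Lp_functions q N \<Longrightarrow>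
      y \<in> Lp_functions p N \<and> Lp_seminorm p N y \<le> C * Lp_seminorm q N y"
  proof (cases "p = q")
    case True
    then show ?thesis by (intro that[of 1]) auto
  next
    case False
    then have "finitely_many_atoms N" using R[THEN conjunct2, THEN conjunct2] by (rule rev_mp)
    from finitely_many_atoms_Lp_inclusion[OF sigma_N this p q] that show ?thesis .
  qed
  from lower_bound_imp_lifts[OF pos c this] show "\<exists>c. lifts_with_constant c" ..
qed

end

theorem theorem2p3p3:
  fixes \<mu> \<nu> \<mu>s :: "'a measure" and p q :: ennreal and g :: "'a \<Rightarrow> complex"
    and \<rho> :: "'a \<Rightarrow> real" and \<Omega>c \<Omega>s :: "'a set"
  assumes "sigma_finite_measure \<mu>" and "sigma_finite_measure \<nu>" and "sets \<mu> = sets \<nu>"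
    and "1 \<le> p" and "1 \<le> q"
    and "g \<in> borel_measurable \<mu>"
    and "bounded_operator (Lp p \<mu>) (Lp q \<nu>) (mult_op \<nu> g)"
    and "lebesgue_decomposition \<mu> \<nu> \<rho> \<mu>s \<Omega>s" and "\<Omega>c = space \<nu> - \<Omega>s"
  shows
    "(topologically_surjective (Lp p \<mu>) (Lp q \<nu>) (mult_op \<nu> g)
        \<longleftrightarrow>
      topologically_surjective (Lp p (restrict_space \<mu> \<Omega>c)) (Lp q (restrict_space \<nu> \<Omega>c))
        (mult_op (restrict_space \<nu> \<Omega>c) g))
     \<and>
     (topologically_surjective (Lp p \<mu>) (Lp q \<nu>) (mult_op \<nu> g)
        \<longleftrightarrow>
      (AE x in \<nu>. 0 < \<rho> x) \<and>
      (\<exists>c>0. AE x in restrict_space \<nu> \<Omega>c.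
         c \<le> norm (g x * complex_of_real (\<rho> x powr - enn2real (1 / p)))) \<and>
      (p \<noteq> q \<longrightarrow> finitely_many_atoms \<nu>))"
proof -
  note op = bounded_operator_mult_op_iff[OF assms(3,6,4), of q, THEN iffD1, OF assms(7)]
  from op obtain K where K: "\<And>f. f \<in> Lp_functions p \<mu> \<Longrightarrow>
      Lp_seminorm q \<nu> (\<lambda>x. g x * f x) \<le> K * Lp_seminorm p \<mu> f" by blast
  have \<Omega>s: "\<Omega>s \<in> null_sets \<nu>" and \<rho>: "\<rho> \<in> borel_measurable \<nu>"
    and \<mu>s: "emeasure \<mu>s \<Omega>c = 0" "sets \<mu>s = sets \<nu>"
    and dec: "\<And>E. E \<in> sets \<nu> \<Longrightarrow>
      emeasure \<mu> E = emeasure (density \<nu> (\<lambda>x. ennreal (\<rho> x))) E + emeasure \<mu>s E"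
    using assms(8,9) by (auto simp: lebesgue_decomposition_def)
  have \<Omega>c: "\<Omega>c \<in> sets \<nu>" using \<Omega>s assms(9) by auto
  have AE_c: "AE x in \<nu>. x \<in> \<Omega>c"
    using AE_not_in[OF \<Omega>s] AE_space by eventually_elim (simp add: assms(9))
  \<comment> \<open>Taking the maximum with \<open>1\<close> makes the bound on the operator positive.\<close>
  interpret Lp_multiplication \<mu> \<nu> \<Omega>c \<rho> p q g "max K 1"
  proof (rule Lp_multiplication.intro)
    show "emeasure \<mu> E = emeasure (density \<nu> (\<lambda>x. ennreal (\<rho> x))) E"
      if "E \<in> sets \<nu>" "E \<subseteq> \<Omega>c" for E
    proof -
      have "emeasure \<mu>s E \<le> emeasure \<mu>s \<Omega>c"
        using that \<Omega>c \<mu>s(2) by (intro emeasure_mono) auto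
      then show ?thesis using dec[OF that(1)] \<mu>s(1) by simp
    qed
    show "g \<in> borel_measurable \<nu>"
      using assms(3,6) by (simp cong: measurable_cong_sets)
    show "AE x in \<nu>. x \<in> E \<longrightarrow> g x = 0" if "E \<in> null_sets \<mu>" for E
      using op that by blast
    show "(\<lambda>x. g x * f x) \<in> Lp_functions q \<nu>" if "f \<in> Lp_functions p \<mu>" for f
      using op that by blast
    show "Lp_seminorm q \<nu> (\<lambda>x. g x * f x) \<le> max K 1 * Lp_seminorm p \<mu> f"
      if "f \<in> Lp_functions p \<mu>" for f
      by (rule order_trans[OF K[OF that] mult_right_mono[OF _ Lp_seminorm_nonneg]]) simp
    show "0 < max K 1" by simp
  qed (fact assms \<Omega>c \<rho> AE_c)+
  have "topologically_surjective (Lp p \<mu>) (Lp q \<nu>) (mult_op \<nu> g) \<longleftrightarrow> (\<exists>c. lifts_with_constant c)"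
    unfolding topologically_surjective_mult_op_iff[OF assms(3,6,4,7)] lifts_with_constant_def ..
  then show ?thesis
    unfolding lifts_iff
    by (intro conjI mult_op_restrict_space[OF assms(3,6,4,5) A_in_M AE_c assms(7)])
qed

end
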